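(* Let $T$ be the Dykema--Haagerup triangular operator and $\phi$ the associated state (both defined in the context). For any $k,n\in\mathbb{N}$ we have $$\phi\big[\big(T^k (T^\star)^k\big)^n\big]=\frac{n^{nk}}{(nk+1)!}.$$
   Context: $\mathbb{N}$ denotes the positive integers. Operator-valued probability space: a triple $(\mathcal{B}\subseteq\mathcal{A},\mathbb{E})$ where $\mathcal{A}$ is a unital $\star$-algebra, $\mathcal{B}\subseteq\mathcal{A}$ a unital $\star$-subalgebra, and $\mathbb{E}:\mathcal{A}\to\mathcal{B}$ is linear with $\mathbb{E}(1)=1$ and $\mathbb{E}(b_1xb_2)=b_1\mathbb{E}(x)b_2$ for all $b_1,b_2\in\mathcal{B}$, $x\in\mathcal{A}$. Nested evaluation: let $\kappa:\mathcal{A}\times\mathcal{A}\to\mathcal{B}$ be bilinear with $\kappa(ba_1,a_2)=b\,\kappa(a_1,a_2)$, $\kappa(a_1b,a_2)=\kappa(a_1,ba_2)$, $\kappa(a_1,a_2b)=\kappa(a_1,a_2)b$ for $b\in\mathcal{B}$, $a_1,a_2\in\mathcal{A}$. $\mathrm{NC}_2(X)$ is the set of noncrossing pair partitions of a finite ordered set $X$ (partitions into two-element blocks with no blocks $\{a,c\},\{b,d\}$ such that $a<b<c<d$). For $\pi\in\mathrm{NC}_2(\{1,\dots,2n\})$ the map $\kappa_\pi:\mathcal{A}^{2n}\to\mathcal{B}$ is defined recursively: it is $1$ for the empty partition, and if $1$ is paired with $2l$ in $\pi$, then $\kappa_\pi(a_1,\dots,a_{2n})=\kappa\big(a_1,\kappa_{\pi'}(a_2,\dots,a_{2l-1})\,a_{2l}\big)\,\kappa_{\pi''}(a_{2l+1},\dots,a_{2n})$,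 where $\pi',\pi''$ are the restrictions of $\pi$ to $\{2,\dots,2l-1\}$ and $\{2l+1,\dots,2n\}$. Generalized circular element with variance $\kappa$: an element $T\in\mathcal{A}$ such that, with $\kappa:\mathcal{A}\times\mathcal{A}\to\mathcal{B}$ a bilinear map satisfying $\kappa(ba_1,a_2)=b\,\kappa(a_1,a_2)$, $\kappa(a_1b,a_2)=\kappa(a_1,ba_2)$ and $\kappa(a_1,a_2b)=\kappa(a_1,a_2)b$ for all $b\in\mathcal{B}$, $a_1,a_2\in\mathcal{A}$, and with $\kappa_\pi$ the nested evaluation maps determined by $\kappa$, for all $n$, all $b_i\in\mathcal{B}$ and all $s_i\in\{1,\star\}$ (where $T^1=T$ and $T^\star$ is the adjoint of $T$), $\mathbb{E}(b_1T^{s_1}\cdots b_{2n}T^{s_{2n}})=\sum_{\pi\in\mathrm{NC}_2(\{1,\dots,2n\})}\kappa_\pi(b_1T^{s_1},\dots,b_{2n}T^{s_{2n}})$ and $\mathbb{E}(b_1T^{s_1}\cdots b_{2n+1}T^{s_{2n+1}})=0$. Triangular operator: $\mathcal{B}=\mathbb{C}[x]$ is the $\star$-algebra of polynomials in one variable (usual multiplication), $(\mathcal{B}\subset\mathcal{A},\mathbb{E})$ is an operator-valued probability space, and the Dykema--Haagerup triangular operator $T\in\mathcal{A}$ is the generalized circular element whose variance $\kappa$ satisfies, for every $b\in\mathcal{B}$, $[\kappa(T,bT^\star)](x)=\int_x^1 b(t)\,dt$, $[\kappa(T^\star,bT)](x)=\int_0^x b(t)\,dt$, $\kappa(T,bT)=0$,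 $\kappa(T^\star,bT^\star)=0$. It is assumed that $\mathcal{A}$ is generated as an algebra by $\mathcal{B}$, $T$ and $T^\star$. State: $\phi:\mathcal{A}\to\mathbb{C}$ is defined by $\phi(b)=\int_0^1 b(x)\,dx$ for $b\in\mathcal{B}$ and $\phi(a)=\phi(\mathbb{E}(a))$ for $a\in\mathcal{A}$. *)

theory Defs
  imports "HOL-Analysis.Analysis" "HOL-Computational_Algebra.Polynomial"
    "HOL-Library.Disjoint_Sets"
begin

locale unital_star_algebra = vector_space scale
  for scale :: "complex \<Rightarrow> 'a::ring_1 \<Rightarrow> 'a" +
  fixes star :: "'a \<Rightarrow> 'a"
  assumes scale_mult_left: "scale c x * y = scale c (x * y)"
    and scale_mult_right: "x * scale c y = scale c (x * y)"
    and star_add: "star (x + y) = star x + star y"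
    and star_scale: "star (scale c x) = scale (cnj c) (star x)"
    and star_mult: "star (x * y) = star y * star x"
    and star_star: "star (star x) = x"
begin

definition subalgebra :: "'a set \<Rightarrow> bool" where
  "subalgebra S \<longleftrightarrow> subspace S \<and> (\<forall>x\<in>S. \<forall>y\<in>S. x * y \<in> S)"

definition unital_star_subalgebra :: "'a set \<Rightarrow> bool" where
  "unital_star_subalgebra S \<longleftrightarrow> subalgebra S \<and> 1 \<in> S \<and> (\<forall>x\<in>S. star x \<in> S)"

end

locale operator_valued_probability_space = unital_star_algebra scale star
  for scale :: "complex \<Rightarrow> 'a::ring_1 \<Rightarrow> 'a" and star :: "'a \<Rightarrow> 'a" +
  fixes B :: "'a set" and E :: "'a \<Rightarrow> 'a"
  assumes B_subalgebra: "unital_star_subalgebra B"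
    and E_in_B: "E x \<in> B"
    and E_linear: "Vector_Spaces.linear scale scale E"
    and E_one: "E 1 = 1"
    and E_bimodule: "b1 \<in> B \<Longrightarrow> b2 \<in> B \<Longrightarrow> E (b1 * x * b2) = b1 * E x * b2"

definition NC2 :: "'i::linorder set \<Rightarrow> 'i set set set" where
  "NC2 X = {\<pi>. finite X \<and> partition_on X \<pi> \<and> (\<forall>V\<in>\<pi>. card V = 2) \<and>
     \<not> (\<exists>a b c d. a < b \<and> b < c \<and> c < d \<and> {a, c} \<in> \<pi> \<and> {b, d} \<in> \<pi>)}"

definition restrict_blocks :: "'i set set \<Rightarrow> 'i set \<Rightarrow> 'i set set" where
  "restrict_blocks \<pi> S = {V \<in> \<pi>. V \<subseteq> S}"

definition partner :: "'i set set \<Rightarrow> 'i \<Rightarrow> 'i" where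
  "partner \<pi> i = (THE j. {i, j} \<in> \<pi>)"

lemma partner_in_block:
  assumes "\<pi> \<in> NC2 X" "i \<in> X"
  shows "{i, partner \<pi> i} \<in> \<pi>"
proof -
  have part: "partition_on X \<pi>" and two: "\<And>V. V \<in> \<pi> \<Longrightarrow> card V = 2"
    using assms(1) by (auto simp: NC2_def)
  obtain V where V: "V \<in> \<pi>" "i \<in> V"
    using part assms(2) by (auto simp: partition_on_def)
  then obtain j where "V = {i, j}" "i \<noteq> j"
    using two[OF V(1)] unfolding card_2_iff by blast
  with V(1) have j: "{i, j} \<in> \<pi>" "i \<noteq> j" by auto
  have "k = j" if k: "{i, k} \<in> \<pi>" for k
  proof -
    have "{i, k} \<inter> {i, j} \<noteq> {}" by simp
    then have "{i, k} = {i, j}"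
      using disjointD[OF partition_onD2[OF part] k j(1)] by metis
    moreover have "i \<noteq> k" using two[OF k] by auto
    ultimately show ?thesis using j(2) by (auto simp: doubleton_eq_iff)
  qed
  with j show ?thesis unfolding partner_def by (metis (mono_tags, lifting) theI)
qed

text \<open>A partition determines its ground set as the union of its blocks, and the arguments keep
  their original indices under restriction. So \<open>nested \<kappa> a \<pi>\<close> is the nested evaluation
  of \<open>\<pi>\<close> at the family \<open>a\<close> restricted to \<open>\<Union>\<pi>\<close>; the value \<open>0\<close> is a dummy outside the
  noncrossing pair partitions.\<close>

function nested :: "('a \<Rightarrow> 'a \<Rightarrow> 'a::ring_1) \<Rightarrow> ('i::linorder \<Rightarrow> 'a) \<Rightarrow> 'i set set \<Rightarrow> 'a" where
  "nested \<kappa> a \<pi> =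
    (if \<pi> = {} then 1
     else if \<pi> \<notin> NC2 (\<Union>\<pi>) then 0
     else let i = Min (\<Union>\<pi>); l = partner \<pi> i in
       \<kappa> (a i) (nested \<kappa> a (restrict_blocks \<pi> {i<..<l}) * a l) *
       nested \<kappa> a (restrict_blocks \<pi> {l<..}))"
  by auto

termination
proof -
  have dec: "card (\<Union>(restrict_blocks \<pi> {Min (\<Union>\<pi>)<..<partner \<pi> (Min (\<Union>\<pi>))})) < card (\<Union>\<pi>)
      \<and> card (\<Union>(restrict_blocks \<pi> {partner \<pi> (Min (\<Union>\<pi>))<..})) < card (\<Union>\<pi>)"
    if "\<pi> \<noteq> {}" and nc: "\<pi> \<in> NC2 (\<Union>\<pi>)" for \<pi> :: "'i::linorder set set"
  proof -
    define i where "i = Min (\<Union>\<pi>)"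
    have fin: "finite (\<Union>\<pi>)" and part: "partition_on (\<Union>\<pi>) \<pi>"
      using nc unfolding NC2_def by blast+
    obtain V where "V \<in> \<pi>" using \<open>\<pi> \<noteq> {}\<close> by blast
    moreover from this have "V \<noteq> {}" using partition_onD3[OF part] by metis
    ultimately have "\<Union>\<pi> \<noteq> {}" by blast
    then have i: "i \<in> \<Union>\<pi>" unfolding i_def by (rule Min_in[OF fin])
    have "partner \<pi> i \<in> \<Union>\<pi>"
      by (rule UnionI[OF partner_in_block[OF nc i]]) simp
    then have "i \<le> partner \<pi> i" unfolding i_def by (rule Min_le[OF fin])
    have "card (\<Union>(restrict_blocks \<pi> S)) < card (\<Union>\<pi>)"
      if "S = {i<..<partner \<pi> i} \<or> S = {partner \<pi> i<..}" for S
    proof -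
      have "i \<notin> S" using that
      proof
        assume "S = {i<..<partner \<pi> i}"
        then show ?thesis by simp
      next
        assume "S = {partner \<pi> i<..}"
        with \<open>i \<le> partner \<pi> i\<close> show ?thesis by simp
      qed
      then have "i \<notin> \<Union>(restrict_blocks \<pi> S)" unfolding restrict_blocks_def by blast
      moreover have "\<Union>(restrict_blocks \<pi> S) \<subseteq> \<Union>\<pi>" unfolding restrict_blocks_def by blast
      ultimately have "\<Union>(restrict_blocks \<pi> S) \<subset> \<Union>\<pi>" using i by (metis psubsetI)
      then show ?thesis by (rule psubset_card_mono[OF fin])
    qed
    then show ?thesis unfolding i_def by (intro conjI) simp_all
  qed
  show ?thesis
  proof (relation "Wellfounded.measure (\<lambda>(\<kappa>, a, \<pi>). card (\<Union>\<pi>))", goal_cases)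
    case 1
    show ?case by simp
  next
    case (2 \<kappa> a \<pi> i l)
    then have "\<pi> \<in> NC2 (\<Union>\<pi>)" by blast
    from dec[OF 2(1) this] show ?case unfolding 2(3,4) in_measure prod.case by blast
  next
    case (3 \<kappa> a \<pi> i l)
    then have "\<pi> \<in> NC2 (\<Union>\<pi>)" by blast
    from dec[OF 3(1) this] show ?case unfolding 3(3,4) in_measure prod.case by blast
  qed
qed

declare nested.simps [simp del]

datatype star_exponent = One_exp | Star_exp

context operator_valued_probability_space
begin

fun star_pow :: "'a \<Rightarrow> star_exponent \<Rightarrow> 'a" where
  "star_pow T One_exp = T"
| "star_pow T Star_exp = star T"

definition B_bilinear :: "('a \<Rightarrow> 'a \<Rightarrow> 'a) \<Rightarrow> bool" where
  "B_bilinear \<kappa> \<longleftrightarrow>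
    (\<forall>a1 a2. \<kappa> a1 a2 \<in> B) \<and>
    (\<forall>a1. Vector_Spaces.linear scale scale (\<kappa> a1)) \<and>
    (\<forall>a2. Vector_Spaces.linear scale scale (\<lambda>a1. \<kappa> a1 a2)) \<and>
    (\<forall>b\<in>B. \<forall>a1 a2. \<kappa> (b * a1) a2 = b * \<kappa> a1 a2 \<and>
       \<kappa> (a1 * b) a2 = \<kappa> a1 (b * a2) \<and>
       \<kappa> a1 (a2 * b) = \<kappa> a1 a2 * b)"

text \<open>The quantification over \<open>n\<close> includes \<open>0\<close>, so that \<open>E (b * T) = E (b * star T) = 0\<close>.\<close>

definition generalized_circular :: "('a \<Rightarrow> 'a \<Rightarrow> 'a) \<Rightarrow> 'a \<Rightarrow> bool" where
  "generalized_circular \<kappa> T \<longleftrightarrow> B_bilinear \<kappa> \<and>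
    (\<forall>(n::nat) (b :: nat \<Rightarrow> 'a) (s :: nat \<Rightarrow> star_exponent). (\<forall>i. b i \<in> B) \<longrightarrow>
       E (prod_list (map (\<lambda>i. b i * star_pow T (s i)) [1..<2*n+1])) =
         (\<Sum>\<pi>\<in>NC2 {1..2*n}. nested \<kappa> (\<lambda>i. b i * star_pow T (s i)) \<pi>) \<and>
       E (prod_list (map (\<lambda>i. b i * star_pow T (s i)) [1..<2*n+2])) = 0)"

end

text \<open>The subalgebra \<open>B\<close> is a copy of \<open>\<complex>[x]\<close>, identified through the \<open>\<star>\<close>-isomorphism \<open>\<iota>\<close>; the
  variable \<open>x\<close> is self-adjoint, so the involution conjugates coefficients.\<close>

locale polynomial_probability_space =
  operator_valued_probability_space scale star B E
  for scale :: "complex \<Rightarrow> 'a::ring_1 \<Rightarrow> 'a" and star :: "'a \<Rightarrow> 'a"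
    and B :: "'a set" and E :: "'a \<Rightarrow> 'a" +
  fixes \<iota> :: "complex poly \<Rightarrow> 'a"
  assumes iota_bij: "bij_betw \<iota> UNIV B"
    and iota_add: "\<iota> (p + q) = \<iota> p + \<iota> q"
    and iota_smult: "\<iota> (smult c p) = scale c (\<iota> p)"
    and iota_mult: "\<iota> (p * q) = \<iota> p * \<iota> q"
    and iota_one: "\<iota> 1 = 1"
    and iota_star: "\<iota> (map_poly cnj p) = star (\<iota> p)"

definition eval_B :: "(complex poly \<Rightarrow> 'a) \<Rightarrow> 'a \<Rightarrow> real \<Rightarrow> complex" where
  "eval_B \<iota> b x = poly (inv \<iota> b) (of_real x)"

definition state_phi :: "(complex poly \<Rightarrow> 'a) \<Rightarrow> ('a \<Rightarrow> 'a) \<Rightarrow> 'a \<Rightarrow> complex" where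
  "state_phi \<iota> E a = integral {0..1} (eval_B \<iota> (E a))"

text \<open>The variance identities are required for \<open>x\<close> in \<open>[0, 1]\<close>, which determines the polynomials
  involved and keeps both integrals over genuine intervals.\<close>

locale triangular_operator = polynomial_probability_space scale star B E \<iota>
  for scale :: "complex \<Rightarrow> 'a::ring_1 \<Rightarrow> 'a" and star :: "'a \<Rightarrow> 'a"
    and B :: "'a set" and E :: "'a \<Rightarrow> 'a" and \<iota> :: "complex poly \<Rightarrow> 'a" +
  fixes \<kappa> :: "'a \<Rightarrow> 'a \<Rightarrow> 'a" and T :: 'a
  assumes circular: "generalized_circular \<kappa> T"
    and variance_T_star: "b \<in> B \<Longrightarrow> x \<in> {0..1} \<Longrightarrow>
      eval_B \<iota> (\<kappa> T (b * star T)) x = integral {x..1} (eval_B \<iota> b)"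
    and variance_star_T: "b \<in> B \<Longrightarrow> x \<in> {0..1} \<Longrightarrow>
      eval_B \<iota> (\<kappa> (star T) (b * T)) x = integral {0..x} (eval_B \<iota> b)"
    and variance_T_T: "b \<in> B \<Longrightarrow> \<kappa> T (b * T) = 0"
    and variance_star_star: "b \<in> B \<Longrightarrow> \<kappa> (star T) (b * star T) = 0"
    and generated: "subalgebra hull (B \<union> {T, star T}) = UNIV"

end

theory Submission
  imports Defs "HOL-Computational_Algebra.Formal_Laurent_Series"
begin

text \<open>For a word in \<open>T\<close> and \<open>T\<^sup>\<star>\<close> the conditional expectation is a polynomial in \<open>x\<close>, and the first arc of
a noncrossing pairing gives a recursion for it (\<open>sum_nested_first_arc\<close>): the first letter is paired with
some later letter of the opposite kind, the enclosed word contributes its moment integrated over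
\<open>[x, 1]\<close> or \<open>[0, x]\<close>, and the remaining word contributes its moment as a factor.

Read \<open>(T\<^sup>k (T\<^sup>\<star>)\<^sup>k)\<^sup>n\<close> as a zigzag path between the heights \<open>0\<close> and \<open>k\<close> that starts at the top, where
\<open>T\<close> is a step down. Only subwords that start and end at the same height can have a nonzero moment.
Let \<open>z\<close> count the visits to the top, where the convention for end points at the top is fixed by
\<open>P\<^sub>k = z\<close> below. For each height \<open>h\<close> there are three generating functions: \<open>r\<^sub>h\<close> for the
subwords that return to \<open>h\<close> in the direction in which they left, \<open>p\<^sub>h\<close> for those that first go up and in
the end come down, and \<open>q\<^sub>h\<close> for those that first go down and in the end come up. The recursion says
\<open>p\<^sub>h = P\<^sub>h r\<^sub>h\<close>, \<open>q\<^sub>h = Q\<^sub>h r\<^sub>h\<close> and \<open>r\<^sub>h (1 - P\<^sub>h Q\<^sub>h) = 1\<close>, where \<open>P\<^sub>h\<close> is the integral of \<open>p\<close> at height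
\<open>h + 1\<close> over \<open>[0, x]\<close> and \<open>Q\<^sub>h\<close> the integral of \<open>q\<close> at height \<open>h - 1\<close> over \<open>[x, 1]\<close>; at the ends of the ladder
\<open>P\<^sub>k = z\<close> and \<open>Q\<^sub>0 = 1\<close>. Differentiation in \<open>x\<close> turns this into a ladder of nonlinear differential
equations.

The ladder is integrable. Its Lax pair (\<open>Lax_pair\<close>) consists of two sequences \<open>\<psi>\<^sub>h\<close>, \<open>\<theta>\<^sub>h\<close> that depend on a
spectral parameter \<open>\<zeta>\<close>, and it shows that \<open>\<chi>(\<zeta>) = \<psi>\<^sub>k\<close> does not depend on \<open>x\<close> and that \<open>\<theta>\<^sub>k\<close> satisfies a
linear equation. Comparison of \<open>x = 0\<close> with \<open>x = 1\<close> yields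
\<open>K (\<zeta>\<^sup>k - z e\<^sup>\<zeta>) = \<chi>(\<zeta>) V(\<zeta>)\<close>, where \<open>K\<close> is the value of \<open>r\<^sub>k\<close> at \<open>0\<close>, \<open>\<chi>\<close> is a monic polynomial
of degree \<open>k\<close> in \<open>\<zeta>\<close>, and \<open>V(\<zeta>) = 1 - \<zeta> \<integral> e\<^bsup>\<zeta>x\<^esup> (r\<^sub>k - 1) dx\<close> is a power series in \<open>\<zeta>\<close>; the integral runs
over \<open>[0, 1]\<close>.

Division by \<open>K \<zeta>\<^sup>k\<close> splits \<open>1 - z A\<close>, with \<open>A = \<zeta>\<^bsup>-k\<^esup> e\<^sup>\<zeta>\<close>, into a factor without positive powers of \<open>\<zeta>\<close>
and one without negative powers. The logarithmic derivative in \<open>z\<close> separates the two factors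
(\<open>Birkhoff_factor_first_coefficient\<close>), and its coefficients at \<open>\<zeta>\<close> say that \<open>n\<close> times the coefficient of
\<open>z\<^sup>n\<close> in \<open>\<integral> r\<^sub>k dx\<close> is the coefficient of \<open>\<zeta>\<close> in \<open>A\<^sup>n\<close>, which is \<open>n\<^bsup>nk+1\<^esup> / (nk + 1)!\<close>
(\<open>ladder_integral\<close>). The coefficient of \<open>z\<^sup>n\<close> in \<open>r\<^sub>k\<close> is the conditional expectation in question
(\<open>integral_zigzag_moment\<close>, \<open>E_power\<close>).\<close>

unbundle no vec_syntax and fps_syntax

section \<open>Coefficientwise maps of formal power series\<close>

definition fps_map :: "('a \<Rightarrow> 'b) \<Rightarrow> 'a::zero fps \<Rightarrow> 'b::zero fps" where
  "fps_map f F = Abs_fps (\<lambda>n. f (F $ n))"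

lemma fps_map_nth [simp]: "fps_map f F $ n = f (F $ n)"
  by (simp add: fps_map_def)

definition unital_hom :: "('a::comm_ring_1 \<Rightarrow> 'b::comm_ring_1) \<Rightarrow> bool" where
  "unital_hom f \<longleftrightarrow> f 1 = 1 \<and> (\<forall>x y. f (x + y) = f x + f y) \<and> (\<forall>x y. f (x * y) = f x * f y)"

definition derivation :: "('a::comm_ring_1 \<Rightarrow> 'a) \<Rightarrow> bool" where
  "derivation d \<longleftrightarrow> (\<forall>x y. d (x + y) = d x + d y) \<and> (\<forall>x y. d (x * y) = d x * y + x * d y)"

lemma additive_0: "f 0 = 0" if "\<And>x y. f (x + y) = f x + f y" for f :: "'a::ab_group_add \<Rightarrow> 'b::ab_group_add"
  using that[of 0 0] by simp

lemma additive_diff: "f (x - y) = f x - f y" if "\<And>x y. f (x + y) = f x + f y"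
  for f :: "'a::ab_group_add \<Rightarrow> 'b::ab_group_add"
  using that[of "x - y" y] by (simp add: eq_diff_eq)

lemma additive_sum: "f (sum g A) = (\<Sum>a\<in>A. f (g a))" if "\<And>x y. f (x + y) = f x + f y"
  for f :: "'a::ab_group_add \<Rightarrow> 'b::ab_group_add"
  by (induction A rule: infinite_finite_induct) (simp_all add: that additive_0[of f, OF that])

lemma unital_hom_fps_map:
  assumes "unital_hom f" shows "unital_hom (fps_map f)"
proof -
  have add: "f (x + y) = f x + f y" and mult: "f (x * y) = f x * f y" and one: "f 1 = 1" for x y
    using assms by (auto simp: unital_hom_def)
  note [simp] = additive_0[of f, OF add] additive_sum[of f, OF add] add mult one
  show ?thesis
    unfolding unital_hom_def
    by (intro conjI allI fps_ext) (simp_all add: fps_mult_nth)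
qed

lemma derivation_fps_map:
  assumes "derivation d" shows "derivation (fps_map d)"
proof -
  have add: "d (x + y) = d x + d y" and mult: "d (x * y) = d x * y + x * d y" for x y
    using assms by (auto simp: derivation_def)
  show ?thesis
    unfolding derivation_def
    by (intro conjI allI fps_ext)
       (simp_all add: fps_mult_nth additive_sum[of d, OF add] add mult sum.distrib)
qed

lemma
  assumes "unital_hom f"
  shows unital_hom_1: "f 1 = 1" and unital_hom_add: "f (x + y) = f x + f y"
    and unital_hom_mult: "f (x * y) = f x * f y" and unital_hom_0: "f 0 = 0"
    and unital_hom_diff: "f (x - y) = f x - f y" and unital_hom_power: "f (x ^ n) = f x ^ n"
    and unital_hom_uminus: "f (- x) = - f x"
proof -
  show *: "f (x + y) = f x + f y" for x y using assms by (simp add: unital_hom_def)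
  show 1: "f 1 = 1" and 2: "f (x * y) = f x * f y" for x y
    using assms by (simp_all add: unital_hom_def)
  show 0: "f 0 = 0" and "f (x - y) = f x - f y"
    using additive_0[of f, OF *] additive_diff[of f, OF *] by auto
  show "f (- x) = - f x"
    using additive_diff[of f 0 x, OF *] 0 by simp
  show "f (x ^ n) = f x ^ n" by (induction n) (simp_all add: 1 2)
qed

lemmas unital_hom_simps =
  unital_hom_1 unital_hom_add unital_hom_mult unital_hom_0 unital_hom_diff unital_hom_power unital_hom_uminus

section \<open>Splitting a power series over Laurent series into two factors\<close>

text \<open>The coefficients of \<open>F\<inverse>\<close> are polynomials without constant term in those of \<open>F\<close>.\<close>

lemma inverse_fps_nth_mem:
  fixes F :: "'a::field fps"
  assumes F0: "F $ 0 = 1" and F: "\<And>n. n > 0 \<Longrightarrow> F $ n \<in> S"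
    and zero: "0 \<in> S"
    and add: "\<And>x y. x \<in> S \<Longrightarrow> y \<in> S \<Longrightarrow> x + y \<in> S"
    and minus: "\<And>x. x \<in> S \<Longrightarrow> - x \<in> S"
    and mult: "\<And>x y. x \<in> S \<Longrightarrow> y \<in> S \<Longrightarrow> x * y \<in> S"
    and "n > 0"
  shows "inverse F $ n \<in> S"
  using \<open>n > 0\<close>
proof (induction n rule: less_induct)
  case (less n)
  have sum_mem: "sum f A \<in> S" if "\<And>x. x \<in> A \<Longrightarrow> f x \<in> S" for f :: "nat \<Rightarrow> 'a" and A
    using that zero add by (induction A rule: infinite_finite_induct) auto
  have "F * inverse F = 1"
    using F0 by (simp add: inverse_mult_eq_1')
  then have "(F * inverse F) $ n = 0"
    using less.prems by simp
  moreover have "(F * inverse F) $ n = inverse F $ n + (\<Sum>i\<in>{1..<n}. F $ i * inverse F $ (n - i)) + F $ n"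
  proof -
    have "{0..n} = insert 0 (insert n {1..<n})"
      using less.prems by auto
    then show ?thesis
      using less.prems F0 by (simp add: fps_mult_nth add_ac)
  qed
  ultimately have "inverse F $ n = - ((\<Sum>i\<in>{1..<n}. F $ i * inverse F $ (n - i)) + F $ n)"
    by (simp only: eq_neg_iff_add_eq_0 add.assoc)
  moreover have "(\<Sum>i\<in>{1..<n}. F $ i * inverse F $ (n - i)) \<in> S"
    by (rule sum_mem) (auto intro!: mult F less.IH)
  ultimately show ?case
    using F[OF less.prems] by (simp only: add minus)
qed

definition nonpos_powers :: "'a::comm_ring_1 fls set" where
  "nonpos_powers = {f. \<forall>m>0. f $$ m = 0}"

definition pos_powers :: "'a::comm_ring_1 fls set" where
  "pos_powers = {f. \<forall>m\<le>0. f $$ m = 0}"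

lemma nonpos_powers_mult:
  assumes "f \<in> nonpos_powers" "g \<in> nonpos_powers"
  shows "f * g \<in> nonpos_powers"
proof -
  have "(f * g) $$ m = 0" if "m > 0" for m
    unfolding fls_times_nth(2)
  proof (rule sum.neutral, rule ballI)
    fix i
    show "f $$ i * g $$ (m - i) = 0"
      using assms that by (cases "i > 0") (auto simp: nonpos_powers_def)
  qed
  then show ?thesis by (simp add: nonpos_powers_def)
qed

lemma pos_powers_mult_nth:
  assumes "f \<in> pos_powers" "g \<in> pos_powers" "m \<le> 1"
  shows "(f * g) $$ m = 0"
  unfolding fls_times_nth(2)
proof (rule sum.neutral, rule ballI)
  fix i
  show "f $$ i * g $$ (m - i) = 0"
    using assms by (cases "i > 0") (auto simp: pos_powers_def)
qed

text \<open>A logarithmic derivative turns the product \<open>C V\<close> into the sum \<open>C'/C + V'/V\<close>. The first summand has no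
positive powers of \<open>\<zeta>\<close>, so the coefficient of \<open>\<zeta>\<close> in \<open>-A/(1 - z A)\<close> comes from \<open>V'/V\<close> alone. Since \<open>V\<close> is
\<open>1\<close> up to multiples of \<open>\<zeta>\<close>, division by \<open>V\<close> changes \<open>V'\<close> only from \<open>\<zeta>\<^sup>2\<close> on. Thus the first coefficients of
\<open>V\<close> are determined by \<open>A\<close>, although the factors are not given explicitly.\<close>

lemma Birkhoff_factor_first_coefficient:
  fixes A :: "'a::field fls" and C V :: "'a fls fps"
  assumes factor: "1 - fps_X * fps_const A = C * V"
    and C0: "C $ 0 = 1" and C: "\<And>n. C $ n \<in> nonpos_powers"
    and V0: "V $ 0 = 1" and V: "\<And>n. n > 0 \<Longrightarrow> V $ n \<in> pos_powers"
  shows "of_nat (Suc n) * (V $ Suc n $$ 1) = - ((A ^ Suc n) $$ 1)"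
proof -
  have iC: "inverse C $ i \<in> nonpos_powers" for i
  proof (cases "i = 0")
    case True
    then show ?thesis using C0 by (simp add: nonpos_powers_def)
  next
    case False
    show ?thesis
    proof (rule inverse_fps_nth_mem[OF C0 C])
      show "x * y \<in> nonpos_powers" if "x \<in> nonpos_powers" "y \<in> nonpos_powers" for x y :: "'a fls"
        using that by (rule nonpos_powers_mult)
    qed (use False in \<open>auto simp: nonpos_powers_def\<close>)
  qed
  have iV: "inverse V $ i \<in> pos_powers" if "i > 0" for i
  proof (rule inverse_fps_nth_mem[OF V0 V])
    show "x * y \<in> pos_powers" if "x \<in> pos_powers" "y \<in> pos_powers" for x y :: "'a fls"
      using pos_powers_mult_nth[OF that] by (simp add: pos_powers_def)
  qed (use that in \<open>auto simp: pos_powers_def\<close>)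
  have inv: "C * inverse C = 1" "V * inverse V = 1"
    using C0 V0 by (simp_all add: inverse_mult_eq_1')
  define G where "G = Abs_fps (\<lambda>i. A ^ i)"
  have G: "(1 - fps_X * fps_const A) * G = 1"
  proof (rule fps_ext)
    fix i show "((1 - fps_X * fps_const A) * G) $ i = 1 $ i"
      by (cases i) (simp_all add: G_def left_diff_distrib mult.assoc)
  qed
  have "fps_deriv (1 - fps_X * fps_const A) = - fps_const A"
    by simp
  with factor have d: "- fps_const A = fps_deriv C * V + C * fps_deriv V"
    by (metis fps_deriv_mult add.commute)
  have "- fps_const A * G = - fps_const A * G * (C * inverse C) * (V * inverse V)"
    using inv by simp
  also have "\<dots> = - fps_const A * ((C * V) * G) * inverse C * inverse V"
    by (simp add: algebra_simps)
  also have "\<dots> = (fps_deriv C * V + C * fps_deriv V) * inverse C * inverse V"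
    using G factor d by simp
  also have "\<dots> = fps_deriv C * inverse C * (V * inverse V) + (C * inverse C) * (fps_deriv V * inverse V)"
    by (simp add: algebra_simps)
  also have "\<dots> = fps_deriv C * inverse C + fps_deriv V * inverse V"
    using inv by simp
  finally have eq: "- fps_const A * G = fps_deriv C * inverse C + fps_deriv V * inverse V" .
  have "(fps_deriv C * inverse C) $ n $$ 1 = 0"
    unfolding fps_mult_nth fls_nth_sum
  proof (rule sum.neutral, rule ballI)
    fix i
    have "fps_deriv C $ i \<in> nonpos_powers"
      using C[of "Suc i"] by (simp add: nonpos_powers_def del: of_nat_Suc)
    from nonpos_powers_mult[OF this iC] show "(fps_deriv C $ i * inverse C $ (n - i)) $$ 1 = 0"
      by (simp add: nonpos_powers_def)
  qed
  moreover have "(fps_deriv V * inverse V) $ n $$ 1 = of_nat (Suc n) * (V $ Suc n $$ 1)"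
  proof -
    have "(fps_deriv V * inverse V) $ n = fps_deriv V $ n + (\<Sum>i<n. fps_deriv V $ i * inverse V $ (n - i))"
    proof -
      have "{0..n} = insert n {..<n}" by auto
      then show ?thesis using V0 by (simp add: fps_mult_nth)
    qed
    moreover have "(\<Sum>i<n. fps_deriv V $ i * inverse V $ (n - i)) $$ 1 = 0"
      unfolding fls_nth_sum
    proof (rule sum.neutral, rule ballI)
      fix i assume "i \<in> {..<n}"
      moreover have "fps_deriv V $ i \<in> pos_powers"
        using V[of "Suc i"] by (simp add: pos_powers_def del: of_nat_Suc)
      ultimately show "(fps_deriv V $ i * inverse V $ (n - i)) $$ 1 = 0"
        by (intro pos_powers_mult_nth iV) auto
    qed
    ultimately show ?thesis by (simp del: of_nat_Suc)
  qed
  moreover have "(- fps_const A * G) $ n = - (A ^ Suc n)"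
    unfolding G_def fps_const_neg fps_mult_left_const_nth by simp
  ultimately show ?thesis
    unfolding eq by (metis add_0 fls_plus_nth fls_uminus_nth fps_add_nth)
qed

section \<open>The ladder equations and their Lax pair\<close>

text \<open>The two recursions in \<open>h\<close> and the two equations for \<open>d\<close> are compatible because \<open>P\<close>, \<open>Q\<close>, \<open>r\<close> solve
the ladder equations; this is a zero-curvature condition, of the kind known from the Ablowitz-Ladik
lattice. If \<open>d (P k) = 0\<close>, the case \<open>h = k\<close> says that \<open>\<psi> k\<close> is constant, and the equation for
\<open>\<theta> k\<close> becomes linear with a constant coefficient. The spectral
parameter is any constant, and below it is an indeterminate in one place and \<open>0\<close> in another.\<close>

lemma Lax_pair:
  fixes d :: "'r::comm_ring_1 \<Rightarrow> 'r" and P Q r \<psi> \<theta> :: "nat \<Rightarrow> 'r" and \<zeta> :: 'r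
  assumes d_add: "\<And>x y. d (x + y) = d x + d y"
    and d_mult: "\<And>x y. d (x * y) = d x * y + x * d y"
    and d_zeta: "d \<zeta> = 0"
    and unit: "\<And>h. h \<le> k \<Longrightarrow> r h * (1 - P h * Q h) = 1"
    and dP: "\<And>h. h < k \<Longrightarrow> d (P h) = P (Suc h) * r (Suc h)"
    and dQ: "\<And>h. h < k \<Longrightarrow> d (Q (Suc h)) = - (Q h * r h)"
    and Q0: "Q 0 = 1"
    and psi0: "\<psi> 0 = 1" and theta0: "\<theta> 0 = r 0"
    and psi: "\<And>h. \<psi> (Suc h) = \<zeta> * \<psi> h - P (Suc h) * r (Suc h) * \<theta> h"
    and theta: "\<And>h. \<theta> (Suc h) = r (Suc h) * (Q (Suc h) * \<zeta> * \<psi> h + \<theta> h)"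
  shows "h \<le> k \<Longrightarrow> d (\<psi> h) = d (P h) * (Q h * r h * \<psi> h - \<theta> h) \<and>
    d (\<theta> h) = d (P h) * (Q h * r h) * \<theta> h - \<zeta> * (\<theta> h - Q h * r h * \<psi> h)"
proof -
  have d1: "d 1 = 0" using d_mult[of 1 1] by simp
  have d0: "d 0 = 0" using d_add[of 0 0] by simp
  have d_minus: "d (- x) = - d x" for x
    using d_add[of x "- x"] d0 by (simp add: eq_neg_iff_add_eq_0 add.commute)
  have d_diff: "d (x - y) = d x - d y" for x y
    using d_add[of x "- y"] d_minus by simp
  have dr: "d (r h) = r h * r h * (d (P h) * Q h + P h * d (Q h))" if "h \<le> k" for h
  proof -
    have "d (r h * (1 - P h * Q h)) = 0" using unit[OF that] d1 by simp
    then have "d (r h) * (1 - P h * Q h) = r h * (d (P h) * Q h + P h * d (Q h))"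
      by (simp add: d_mult d_diff d1 diff_eq_eq eq_diff_eq algebra_simps)
    then have "d (r h) * (r h * (1 - P h * Q h)) = r h * (r h * (d (P h) * Q h + P h * d (Q h)))"
      by (simp add: mult.left_commute)
    then show ?thesis using unit[OF that] by (simp add: mult.assoc)
  qed
  show "h \<le> k \<Longrightarrow> d (\<psi> h) = d (P h) * (Q h * r h * \<psi> h - \<theta> h) \<and>
    d (\<theta> h) = d (P h) * (Q h * r h) * \<theta> h - \<zeta> * (\<theta> h - Q h * r h * \<psi> h)"
  proof (induction h)
    case 0
    show ?case using dr[of 0] by (simp add: psi0 theta0 Q0 d1 algebra_simps)
  next
    case (Suc h)
    define p q' where "p = P (Suc h) * r (Suc h)" and "q' = Q h * r h"
    define e where "e = d (P (Suc h))"
    define \<rho> where "\<rho> = r (Suc h)"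
    define PP QQ where "PP = P (Suc h)" and "QQ = Q (Suc h)"
    define s t where "s = \<psi> h" and "t = \<theta> h"
    have p: "p = PP * \<rho>" by (simp add: p_def PP_def \<rho>_def)
    have ih1: "d s = p * (q' * s - t)" and ih2: "d t = p * q' * t - \<zeta> * (t - q' * s)"
      using Suc.IH Suc.prems dP[of h] by (simp_all add: s_def t_def p_def q'_def)
    have dQQ: "d QQ = - q'" using dQ[of h] Suc.prems by (simp add: QQ_def q'_def)
    have d\<rho>: "d \<rho> = \<rho> * \<rho> * (e * QQ - PP * q')"
      using dr[OF Suc.prems] dQQ by (simp add: \<rho>_def e_def QQ_def PP_def)
    have dPP: "d PP = e" by (simp add: e_def PP_def)
    have psiS: "\<psi> (Suc h) = \<zeta> * s - PP * \<rho> * t" using psi by (simp add: s_def t_def PP_def \<rho>_def)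
    have thetaS: "\<theta> (Suc h) = \<rho> * (QQ * \<zeta> * s + t)"
      using theta by (simp add: s_def t_def QQ_def \<rho>_def)
    have "d (\<zeta> * s - PP * \<rho> * t) = e * (QQ * \<rho> * (\<zeta> * s - PP * \<rho> * t) - \<rho> * (QQ * \<zeta> * s + t))"
      by (simp add: d_diff d_mult d_zeta ih1 ih2 d\<rho> dPP p algebra_simps)
    moreover have "d (\<rho> * (QQ * \<zeta> * s + t)) = e * (QQ * \<rho>) * (\<rho> * (QQ * \<zeta> * s + t))
        - \<zeta> * (\<rho> * (QQ * \<zeta> * s + t) - QQ * \<rho> * (\<zeta> * s - PP * \<rho> * t))"
      by (simp add: d_add d_mult d_zeta ih1 ih2 d\<rho> dQQ p algebra_simps)
    ultimately show ?case
      unfolding psiS thetaS e_def PP_def QQ_def \<rho>_def by blast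
  qed
qed

section \<open>From the ladder equations to the integral at the top\<close>

text \<open>An element of \<open>complex poly fps fps\<close> is a power series in \<open>z\<close>, whose coefficients are power series in the
spectral parameter \<open>\<zeta>\<close>, whose coefficients in turn are polynomials in \<open>x\<close>. The variable \<open>z\<close> has to be
the outer one: the final factorization is an identity between power series in \<open>z\<close>, with coefficients
that are Laurent series in \<open>\<zeta>\<close>, and for this reason evaluation at a point \<open>x = c\<close> takes values there.\<close>

definition Dx :: "complex poly fps fps \<Rightarrow> complex poly fps fps" where
  "Dx = fps_map (fps_map pderiv)"

definition ev :: "complex \<Rightarrow> complex poly fps fps \<Rightarrow> complex fls fps" where
  "ev c = fps_map (\<lambda>F. fps_to_fls (fps_map (\<lambda>p. poly p c) F))"

lemma unital_hom_ev: "unital_hom (ev c)"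
proof -
  have "unital_hom (\<lambda>p. poly p c)" by (simp add: unital_hom_def)
  then have "unital_hom (fps_map (\<lambda>p. poly p c))" by (rule unital_hom_fps_map)
  moreover have "unital_hom (fps_to_fls :: complex fps \<Rightarrow> complex fls)"
    by (simp add: unital_hom_def fls_times_fps_to_fls)
  ultimately have "unital_hom (\<lambda>F. fps_to_fls (fps_map (\<lambda>p. poly p c) F))"
    by (simp add: unital_hom_def)
  then show ?thesis unfolding ev_def by (rule unital_hom_fps_map)
qed

lemma derivation_Dx: "derivation Dx"
  unfolding Dx_def
  by (intro derivation_fps_map) (simp add: derivation_def pderiv_add pderiv_mult algebra_simps)

lemma Dx_eq_0_imp_ev_eq:
  assumes "Dx F = 0" shows "ev c F = ev c' F"
proof -
  have "poly (F $ n $ m) c = poly (F $ n $ m) c'" for n m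
  proof -
    have "Dx F $ n $ m = 0" using assms by simp
    then obtain a where "F $ n $ m = [:a:]"
      unfolding Dx_def using pderiv_iszero by auto
    then show ?thesis by simp
  qed
  then show ?thesis by (intro fps_ext fls_eqI) (simp add: ev_def)
qed

text \<open>The antiderivative with value \<open>0\<close> at \<open>0\<close>.\<close>

definition pint :: "'a::field_char_0 poly \<Rightarrow> 'a poly" where
  "pint p = (\<Sum>i\<le>degree p. monom (coeff p i / of_nat (Suc i)) (Suc i))"

lemma pderiv_sum: "pderiv (sum f A) = (\<Sum>a\<in>A. pderiv (f a))" for f :: "'b \<Rightarrow> 'a::idom poly"
  by (rule additive_sum[of pderiv, OF pderiv_add])

lemma pderiv_pint: "pderiv (pint p) = p"
proof -
  have "pderiv (pint p) = (\<Sum>i\<le>degree p. monom (coeff p i) i)"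
    unfolding pint_def pderiv_sum pderiv_monom by (simp del: of_nat_Suc)
  then show ?thesis by (simp add: poly_as_sum_of_monoms)
qed

lemma poly_pint_0: "poly (pint p) 0 = 0"
  by (simp add: pint_def poly_sum poly_monom)

lemma pint_0: "pint 0 = 0"
  by (simp add: pint_def)

text \<open>The sequences \<open>\<psi>\<close> and \<open>\<theta>\<close> of the Lax pair.\<close>

fun wave :: "(nat \<Rightarrow> 'r) \<Rightarrow> (nat \<Rightarrow> 'r) \<Rightarrow> (nat \<Rightarrow> 'r) \<Rightarrow> 'r \<Rightarrow> nat \<Rightarrow> 'r::comm_ring_1 \<times> 'r" where
  "wave P Q r \<zeta> 0 = (1, r 0)"
| "wave P Q r \<zeta> (Suc h) =
    (\<zeta> * fst (wave P Q r \<zeta> h) - P (Suc h) * r (Suc h) * snd (wave P Q r \<zeta> h),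
     r (Suc h) * (Q (Suc h) * \<zeta> * fst (wave P Q r \<zeta> h) + snd (wave P Q r \<zeta> h)))"

text \<open>A power series in \<open>z\<close> without \<open>\<zeta>\<close>, given by its coefficients.\<close>

definition ser :: "(nat \<Rightarrow> complex poly) \<Rightarrow> complex poly fps fps" where
  "ser c = Abs_fps (\<lambda>n. fps_const (c n))"

lemma ser_nth [simp]: "ser c $ n = fps_const (c n)"
  by (simp add: ser_def)

lemma ev_ser_nth [simp]: "ev c (ser a) $ n = fls_const (poly (a n) c)"
proof -
  have "fps_map (\<lambda>p. poly p c) (fps_const p) = fps_const (poly p c)" for p
    by (rule fps_ext) simp
  then show ?thesis by (simp add: ev_def)
qed

lemma ev_X: "ev c fps_X = fps_X"
  by (intro fps_ext fls_eqI) (auto simp: ev_def fps_X_def)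

lemma ev_zeta: "ev c (fps_const fps_X) = fps_const fls_X"
  by (intro fps_ext fls_eqI) (auto simp: ev_def fps_X_def)

text \<open>The factorization is obtained at \<open>h = k\<close>. With \<open>E = e\<^bsup>\<zeta>x\<^esup>\<close>, the linear equation for \<open>\<theta> k\<close> reads
\<open>(z E \<theta>\<^sub>k)' = \<zeta> \<chi> E (r\<^sub>k - 1)\<close>. At \<open>x = 0\<close> all \<open>P h\<close> with \<open>h < k\<close> vanish, which gives \<open>\<psi> h = \<zeta>\<^sup>h\<close> and hence
\<open>\<chi>\<close> and \<open>\<theta>\<^sub>k\<close>; at \<open>x = 1\<close> all \<open>Q h\<close> with \<open>h > 0\<close> vanish, which makes \<open>\<theta> h\<close> independent of \<open>h\<close>.\<close>

theorem ladder_integral: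
  fixes Pc Qc rc :: "nat \<Rightarrow> nat \<Rightarrow> complex poly" and k :: nat
  defines "P \<equiv> \<lambda>h. ser (Pc h)" and "Q \<equiv> \<lambda>h. ser (Qc h)" and "r \<equiv> \<lambda>h. ser (rc h)"
  assumes k: "k > 0"
    and unit: "\<And>h. h \<le> k \<Longrightarrow> r h * (1 - P h * Q h) = 1"
    and dP: "\<And>h. h < k \<Longrightarrow> Dx (P h) = P (Suc h) * r (Suc h)"
    and dQ: "\<And>h. h < k \<Longrightarrow> Dx (Q (Suc h)) = - (Q h * r h)"
    and Pk: "P k = fps_X" and Q0: "Q 0 = 1"
    and P_at_0: "\<And>h. h < k \<Longrightarrow> ev 0 (P h) = 0"
    and Q_at_1: "\<And>h. h < k \<Longrightarrow> ev 1 (Q (Suc h)) = 0"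
    and rc0: "rc k 0 = 1"
  shows "poly (pint (rc k (Suc n))) 1 = of_nat (Suc n) ^ (Suc n * k) / fact (Suc n * k + 1)"
proof -
  note ev0 = unital_hom_simps[OF unital_hom_ev[of 0]] and ev1 = unital_hom_simps[OF unital_hom_ev[of 1]]
  have Dx_add: "Dx (F + G) = Dx F + Dx G" and Dx_mult: "Dx (F * G) = Dx F * G + F * Dx G" for F G
    using derivation_Dx by (simp_all add: derivation_def)
  have Dx_diff: "Dx (F - G) = Dx F - Dx G" for F G
    by (rule additive_diff[of Dx, OF Dx_add])
  define \<psi> \<theta> where "\<psi> \<zeta> h = fst (wave P Q r \<zeta> h)" and "\<theta> \<zeta> h = snd (wave P Q r \<zeta> h)" for \<zeta> h
  have psi0: "\<psi> \<zeta> 0 = 1" and theta0: "\<theta> \<zeta> 0 = r 0"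
    and psiS: "\<psi> \<zeta> (Suc h) = \<zeta> * \<psi> \<zeta> h - P (Suc h) * r (Suc h) * \<theta> \<zeta> h"
    and thetaS: "\<theta> \<zeta> (Suc h) = r (Suc h) * (Q (Suc h) * \<zeta> * \<psi> \<zeta> h + \<theta> \<zeta> h)" for \<zeta> h
    by (simp_all add: \<psi>_def \<theta>_def)
  have DPk: "Dx (P k) = 0"
    unfolding Pk by (intro fps_ext) (simp add: Dx_def fps_X_def)
  have Lax: "Dx (\<psi> \<zeta> k) = 0" "Dx (\<theta> \<zeta> k) = - (\<zeta> * (\<theta> \<zeta> k - Q k * r k * \<psi> \<zeta> k))"
    if "Dx \<zeta> = 0" for \<zeta>
    using Lax_pair[where d = Dx and P = P and Q = Q and r = r and k = k and h = k and \<zeta> = \<zeta>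
        and \<psi> = "\<psi> \<zeta>" and \<theta> = "\<theta> \<zeta>", OF Dx_add Dx_mult that unit dP dQ Q0 psi0 theta0 psiS thetaS] DPk
    by simp_all
  obtain k' where k': "k = Suc k'" using k by (metis Suc_pred)

  define K where "K = ev 0 (r k)"
  have r_at_0: "ev 0 (r h) = 1" if "h < k" for h
    using arg_cong[OF unit[of h], of "ev 0"] that by (simp add: ev0 P_at_0)
  have r_at_1: "ev 1 (r (Suc h)) = 1" if "h < k" for h
    using arg_cong[OF unit[of "Suc h"], of "ev 1"] that by (simp add: ev1 Q_at_1)
  have psi_at_0: "ev 0 (\<psi> \<zeta> h) = ev 0 \<zeta> ^ h" if "h < k" for \<zeta> h
    using that by (induction h) (simp_all add: psi0 psiS ev0 P_at_0)
  have theta_at_1: "ev 1 (\<theta> \<zeta> h) = ev 1 (r 0)" if "h \<le> k" for \<zeta> h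
    using that by (induction h) (simp_all add: theta0 thetaS ev1 Q_at_1 r_at_1)
  have psi_k_at_0: "ev 0 (\<psi> \<zeta> k) = ev 0 \<zeta> ^ k - fps_X * K * ev 0 (\<theta> \<zeta> k')" for \<zeta>
    using psi_at_0[of k'] Pk by (simp add: k' psiS ev0 ev_X K_def)

  \<comment> \<open>For the spectral parameter \<open>0\<close> the constant \<open>\<psi> k\<close> is \<open>- z r\<^sub>k\<close> at \<open>x = 0\<close> and \<open>- z r\<^sub>0\<close> at \<open>x = 1\<close>.\<close>
  have K1: "ev 1 (r 0) = K"
  proof -
    have Dx0: "Dx 0 = 0" by (rule additive_0[of Dx, OF Dx_add])
    have "ev 0 (\<psi> 0 k) = - (fps_X * K)"
    proof -
      have "ev 0 (\<theta> 0 h) = 1" if "h < k" for h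
        using that by (induction h) (simp_all add: theta0 thetaS ev0 r_at_0)
      then show ?thesis using k by (simp add: psi_k_at_0 ev0) (simp add: k')
    qed
    moreover have "ev 1 (\<psi> 0 k) = - (fps_X * ev 1 (r 0))"
      using Pk r_at_1[of k'] theta_at_1[of k' 0] by (simp add: k' psiS ev1 ev_X)
    ultimately have "fps_X * K = fps_X * ev 1 (r 0)"
      using Dx_eq_0_imp_ev_eq[OF Lax(1)[OF Dx0], of 0 1] by simp
    then show ?thesis by simp
  qed

  define \<zeta> :: "complex poly fps fps" where "\<zeta> = fps_const fps_X"
  \<comment> \<open>\<open>E\<close> is \<open>e\<^bsup>\<zeta>x\<^esup>\<close>: its coefficient at \<open>\<zeta>\<^sup>m\<close> is \<open>x\<^sup>m / m!\<close>.\<close>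
  define E :: "complex poly fps fps" where "E = fps_const (Abs_fps (\<lambda>m. monom (1 / fact m) m))"
  define W where "W = fps_map (fps_map pint) (E * (r k - 1))"
  have D\<zeta>: "Dx \<zeta> = 0" by (intro fps_ext) (simp add: Dx_def \<zeta>_def fps_X_def)
  have Dz: "Dx fps_X = 0" using DPk Pk by simp
  have DE: "Dx E = \<zeta> * E"
  proof (intro fps_ext)
    fix n m show "Dx E $ n $ m = (\<zeta> * E) $ n $ m"
      by (cases m) (simp_all add: Dx_def E_def \<zeta>_def pderiv_monom fps_X_mult_nth divide_simps del: of_nat_Suc)
  qed
  have DW: "Dx W = E * (r k - 1)"
    by (intro fps_ext) (simp add: W_def Dx_def pderiv_pint)
  define \<chi> w where "\<chi> = ev 0 (\<psi> \<zeta> k)" and "w = ev 1 W"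
  define Z :: "complex fls fps" where "Z = fps_const fls_X"
  have ev_z: "ev c \<zeta> = Z" for c by (simp add: \<zeta>_def Z_def ev_zeta)
  have "fps_X * Q k * r k = r k - 1"
    using unit[of k] Pk by (simp add: algebra_simps)
  moreover have "Dx (fps_X * E * \<theta> \<zeta> k - \<zeta> * \<psi> \<zeta> k * W)
      = \<zeta> * E * \<psi> \<zeta> k * (fps_X * Q k * r k - (r k - 1))"
    by (simp add: Dx_diff Dx_mult Dz D\<zeta> DE DW Lax[OF D\<zeta>] algebra_simps)
  ultimately have "Dx (fps_X * E * \<theta> \<zeta> k - \<zeta> * \<psi> \<zeta> k * W) = 0"
    by simp
  from Dx_eq_0_imp_ev_eq[OF this, of 0 1]
  have base: "fps_X * ev 0 E * ev 0 (\<theta> \<zeta> k) - Z * \<chi> * ev 0 W = fps_X * ev 1 E * K - Z * \<chi> * w"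
    using Dx_eq_0_imp_ev_eq[OF Lax(1)[OF D\<zeta>], of 1 0] theta_at_1[of k \<zeta>] K1
    by (simp add: ev0 ev1 ev_X ev_z \<chi>_def w_def)
  have E0: "ev 0 E = 1"
    by (intro fps_ext fls_eqI) (auto simp: ev_def E_def poly_monom)
  have E1: "ev 1 E = fps_const (fps_to_fls (fps_exp 1))"
    by (intro fps_ext fls_eqI) (auto simp: ev_def E_def poly_monom fps_exp_def)
  have W0: "ev 0 W = 0"
    by (intro fps_ext fls_eqI) (auto simp: ev_def W_def poly_pint_0)
  have chi: "\<chi> = Z ^ k - fps_X * K * ev 0 (\<theta> \<zeta> k')"
    by (simp add: \<chi>_def psi_k_at_0 ev_z)
  have theta_k_at_0: "fps_X * ev 0 (\<theta> \<zeta> k) = K * Z ^ k - \<chi>"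
  proof -
    have "fps_X * ev 0 (Q k) * K = K - 1"
      using arg_cong[OF unit[of k], of "ev 0"] Pk by (simp add: ev0 ev_X K_def algebra_simps)
    moreover have "fps_X * ev 0 (\<theta> \<zeta> k) = (fps_X * ev 0 (Q k) * K) * Z ^ k + fps_X * K * ev 0 (\<theta> \<zeta> k')"
      using psi_at_0[of k' \<zeta>] by (simp add: k' thetaS ev0 ev_z K_def algebra_simps)
    ultimately have "fps_X * ev 0 (\<theta> \<zeta> k) = (K - 1) * Z ^ k + fps_X * K * ev 0 (\<theta> \<zeta> k')"
      by (simp only:)
    then show ?thesis unfolding chi by (simp add: algebra_simps)
  qed
  have factor: "K * Z ^ k - fps_X * K * fps_const (fps_to_fls (fps_exp 1)) = \<chi> * (1 - Z * w)"
    using base theta_k_at_0 by (simp add: E0 E1 W0 algebra_simps)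

  define U :: "complex fls fps" where "U = fps_const (fls_X_inv ^ k)"
  have ZU: "Z ^ h * fps_const (fls_X_inv ^ h) = 1" for h
  proof -
    have "fls_X ^ h * fls_X_inv ^ h = (1 :: complex fls)"
      by (simp add: power_mult_distrib[symmetric] fls_X_times_conv_shift)
    then show ?thesis by (simp add: Z_def fps_const_power)
  qed
  have K0: "K $ 0 = 1" by (simp add: K_def r_def rc0)
  have K_inv: "K * inverse K = 1" using K0 by (simp add: inverse_mult_eq_1')
  \<comment> \<open>\<open>\<theta> k'\<close> at \<open>x = 0\<close> has degree less than \<open>k\<close> in \<open>\<zeta>\<close>, so that \<open>C\<close> has no positive powers.\<close>
  define C V A where "C = \<chi> * U * inverse K" and "V = 1 - Z * w"
    and "A = fls_X_inv ^ k * fps_to_fls (fps_exp 1 :: complex fps)"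
  have CV: "1 - fps_X * fps_const A = C * V"
  proof -
    have "C * V = (K * inverse K) * (Z ^ k * U) - fps_X * (K * inverse K) * (U * fps_const (fps_to_fls (fps_exp 1)))"
    proof -
      have "C * V = (U * inverse K) * (\<chi> * (1 - Z * w))" by (simp add: C_def V_def)
      then show ?thesis unfolding factor[symmetric] by (simp add: algebra_simps)
    qed
    then show ?thesis using ZU[of k] K_inv by (simp add: U_def A_def)
  qed
  have C_eq: "C = inverse K - fps_X * (U * ev 0 (\<theta> \<zeta> k'))"
  proof -
    have "C = (Z ^ k * U) * inverse K - fps_X * (K * inverse K) * (U * ev 0 (\<theta> \<zeta> k'))"
      unfolding C_def chi by (simp add: algebra_simps)
    then show ?thesis using ZU[of k] K_inv by (simp add: U_def)
  qed
  have C_0: "C $ 0 = 1" using K0 by (simp add: C_eq)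
  have C_nth: "C $ n \<in> nonpos_powers" for n
  proof -
    have low: "(fps_const (fls_X_inv ^ h) * ev 0 (\<theta> \<zeta> h)) $ n \<in> nonpos_powers" if "h < k" for h n
      using that
    proof (induction h arbitrary: n)
      case 0
      then show ?case by (simp add: theta0 r_at_0 nonpos_powers_def)
    next
      case (Suc h)
      have "fps_const (fls_X_inv ^ Suc h) * ev 0 (\<theta> \<zeta> (Suc h)) =
          ev 0 (Q (Suc h)) * (Z ^ Suc h * fps_const (fls_X_inv ^ Suc h)) +
          fps_const fls_X_inv * (fps_const (fls_X_inv ^ h) * ev 0 (\<theta> \<zeta> h))"
        using Suc.prems by (simp add: thetaS ev0 ev_z r_at_0 psi_at_0 algebra_simps flip: fps_const_mult)
      also have "\<dots> $ n = fls_const (poly (Qc (Suc h) n) 0) +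
          fls_X_inv * (fps_const (fls_X_inv ^ h) * ev 0 (\<theta> \<zeta> h)) $ n"
        unfolding ZU by (simp add: Q_def)
      also have "\<dots> \<in> nonpos_powers"
        using Suc.IH[of n] Suc.prems
        by (simp add: nonpos_powers_def fls_X_inv_times_conv_shift)
      finally show ?case .
    qed
    have "(U * ev 0 (\<theta> \<zeta> k')) $ n \<in> nonpos_powers" for n
    proof -
      have "U * ev 0 (\<theta> \<zeta> k') = fps_const fls_X_inv * (fps_const (fls_X_inv ^ k') * ev 0 (\<theta> \<zeta> k'))"
        by (simp add: U_def k' mult.assoc flip: fps_const_mult)
      then have "(U * ev 0 (\<theta> \<zeta> k')) $ n =
          fls_X_inv * (fps_const (fls_X_inv ^ k') * ev 0 (\<theta> \<zeta> k')) $ n"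
        by (simp only: fps_mult_left_const_nth)
      then show ?thesis
        using low[of k' n] by (simp only: k' lessI) (simp add: nonpos_powers_def fls_X_inv_times_conv_shift)
    qed
    moreover have "inverse K $ n \<in> nonpos_powers" for n
    proof (cases "n = 0")
      case True
      then show ?thesis using K0 by (simp add: nonpos_powers_def)
    next
      case False
      show ?thesis
      proof (rule inverse_fps_nth_mem[OF K0])
        show "x * y \<in> nonpos_powers" if "x \<in> nonpos_powers" "y \<in> nonpos_powers" for x y :: "complex fls"
          using that by (rule nonpos_powers_mult)
      qed (use False in \<open>auto simp: nonpos_powers_def K_def r_def\<close>)
    qed
    ultimately show ?thesis by (simp add: C_eq nonpos_powers_def)
  qed
  have r_k_0: "r k $ 0 = 1" by (simp add: r_def rc0)
  have w0: "w $ 0 = 0"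
  proof -
    have "W $ 0 = 0" by (rule fps_ext) (simp add: W_def r_k_0 pint_0)
    then show ?thesis by (intro fls_eqI) (simp add: w_def ev_def)
  qed
  have V_0: "V $ 0 = 1" by (simp add: V_def Z_def w0)
  have V_nth: "V $ Suc n = - (fls_X * w $ Suc n)" for n
    by (simp add: V_def Z_def)
  have V_pos: "V $ n \<in> pos_powers" if "n > 0" for n
    using V_nth[of "n - 1"] that by (simp add: pos_powers_def fls_X_times_conv_shift w_def ev_def)
  have "of_nat (Suc n) * (V $ Suc n $$ 1) = - ((A ^ Suc n) $$ 1)"
    by (rule Birkhoff_factor_first_coefficient[OF CV C_0 C_nth V_0 V_pos])
  moreover have "V $ Suc n $$ 1 = - poly (pint (rc k (Suc n))) 1"
  proof -
    have "(E * (r k - 1)) $ Suc n $ 0 = rc k (Suc n)"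
      by (simp add: E_def r_def)
    then show ?thesis
      by (simp add: V_nth fls_X_times_conv_shift w_def ev_def W_def)
  qed
  moreover have "(A ^ Suc n) $$ 1 = of_nat (Suc n) ^ (Suc n * k + 1) / fact (Suc n * k + 1)"
  proof -
    have "A ^ Suc n = fls_X_inv ^ (Suc n * k) * fps_to_fls (fps_exp (of_nat (Suc n)))"
      unfolding A_def power_mult_distrib fps_to_fls_power[symmetric] fps_exp_power_mult
      by (simp only: power_mult[symmetric] mult.commute[of k] mult_1_right)
    moreover have "(fls_X_inv ^ m * fps_to_fls (fps_exp a)) $$ 1 = a ^ (m + 1) / fact (m + 1)"
      for m and a :: complex
      by (simp add: fls_X_inv_power_times_conv_shift nat_add_distrib algebra_simps)
    ultimately show ?thesis by (simp only:)
  qed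
  ultimately have "of_nat (Suc n) * poly (pint (rc k (Suc n))) 1 =
      of_nat (Suc n) * (of_nat (Suc n) ^ (Suc n * k) / fact (Suc n * k + 1) :: complex)"
    by (simp del: of_nat_Suc mult_Suc fact_Suc)
  then show ?thesis
    unfolding mult_left_cancel[OF of_nat_neq_0] .
qed

section \<open>Moments of words as polynomials\<close>

definition pint_to_1 :: "complex poly \<Rightarrow> complex poly" where
  "pint_to_1 p = [:poly (pint p) 1:] - pint p"

lemma pderiv_pint_to_1: "pderiv (pint_to_1 p) = - p"
  by (simp add: pint_to_1_def pderiv_diff pderiv_pint)

lemma poly_pint_to_1_1: "poly (pint_to_1 p) 1 = 0"
  by (simp add: pint_to_1_def)

text \<open>The effect of an arc from a letter \<open>T\<^sup>u\<close> to a letter \<open>T\<^sup>v\<close> around a word with moment \<open>p\<close>, that is,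
\<open>\<kappa>(T\<^sup>u, p T\<^sup>v)\<close> as a polynomial.\<close>

fun arc_factor :: "star_exponent \<Rightarrow> star_exponent \<Rightarrow> complex poly \<Rightarrow> complex poly" where
  "arc_factor One_exp Star_exp p = pint_to_1 p"
| "arc_factor Star_exp One_exp p = pint p"
| "arc_factor _ _ p = 0"

text \<open>The conditional expectation of the word with the letters \<open>s a, \<dots>, s (b - 1)\<close>, expanded along the arc of
its first letter. Subwords keep the positions of their letters, so that periodicity of \<open>s\<close> can be used for them.\<close>

function moment :: "(nat \<Rightarrow> star_exponent) \<Rightarrow> nat \<Rightarrow> nat \<Rightarrow> complex poly" where
  "moment s a b = (if b \<le> a then 1
    else (\<Sum>l\<in>{a<..<b}. arc_factor (s a) (s l) (moment s (Suc a) l) * moment s (Suc l) b))"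
  by auto
termination
  by (relation "Wellfounded.measure (\<lambda>(s, a, b). b - a)") auto

declare moment.simps [simp del]

lemma moment_shift: "moment s (a + c) (b + c) = moment (\<lambda>j. s (j + c)) a b"
proof (induction "b - a" arbitrary: a b rule: less_induct)
  case less
  show ?case
  proof (cases "b \<le> a")
    case True
    then show ?thesis by (simp add: moment.simps)
  next
    case False
    have "moment s (a + c) (b + c) =
        (\<Sum>l\<in>{a + c<..<b + c}. arc_factor (s (a + c)) (s l) (moment s (Suc (a + c)) l) * moment s (Suc l) (b + c))"
      using False by (subst moment.simps) simp
    also have "\<dots> = (\<Sum>l\<in>{a<..<b}. arc_factor (s (a + c)) (s (l + c)) (moment s (Suc a + c) (l + c)) * moment s (Suc l + c) (b + c))"
      by (rule sum.reindex_bij_witness[of _ "\<lambda>l. l + c" "\<lambda>l. l - c"]) auto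
    also have "\<dots> = (\<Sum>l\<in>{a<..<b}. arc_factor (s (a + c)) (s (l + c)) (moment (\<lambda>j. s (j + c)) (Suc a) l)
        * moment (\<lambda>j. s (j + c)) (Suc l) b)"
      by (intro sum.cong refl arg_cong2[where f = "(*)"] arg_cong[where f = "arc_factor _ _"] less) auto
    finally show ?thesis using False by (subst (2) moment.simps) simp
  qed
qed

lemma arc_factor_eq_0: "arc_factor x y 0 = 0" "arc_factor x x p = 0"
  by (cases x; cases y; simp add: pint_to_1_def pint_0)+

fun step :: "star_exponent \<Rightarrow> int" where
  "step One_exp = - 1"
| "step Star_exp = 1"

text \<open>An arc joins letters with opposite steps, so any pairing that contributes makes the total height
change zero.\<close>

lemma moment_unbalanced:
  assumes H: "\<And>j. H (Suc j) = H j + step (s j)" and "a \<le> b" and "H a \<noteq> H b"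
  shows "moment s a b = 0"
  using assms(2,3)
proof (induction "b - a" arbitrary: a b rule: less_induct)
  case less
  have "arc_factor (s a) (s l) (moment s (Suc a) l) * moment s (Suc l) b = 0" if l: "a < l" "l < b" for l
  proof (cases "s a = s l \<or> H (Suc a) \<noteq> H l \<or> H (Suc l) \<noteq> H b")
    case True
    moreover have "l - Suc a < b - a" "b - Suc l < b - a" using l by auto
    ultimately show ?thesis
      using less.hyps[of l "Suc a"] less.hyps[of b "Suc l"] l by (auto simp: arc_factor_eq_0)
  next
    case False
    then have "step (s a) + step (s l) = 0"
      by (cases "s a"; cases "s l") auto
    with False have "H a = H b" using H[of a] H[of l] by auto
    then show ?thesis using less.prems by simp
  qed
  then have "(\<Sum>l\<in>{a<..<b}. arc_factor (s a) (s l) (moment s (Suc a) l) * moment s (Suc l) b) = (\<Sum>l\<in>{a<..<b}. 0)"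
    by (intro sum.cong refl) (simp only: greaterThanLessThan_iff)
  moreover have "a < b" using less.prems by (cases "a = b") auto
  ultimately show ?case by (subst moment.simps) simp
qed

section \<open>The periodic word\<close>

lemma residue_class_between:
  fixes m :: nat
  assumes "a < l0" "l0 \<le> a + m" "b \<le> l0 + m * N" and last: "N = 0 \<or> l0 + m * (N - 1) < b"
  shows "{l \<in> {a<..<b}. l mod m = l0 mod m} = (\<lambda>i. l0 + m * i) ` {..<N}"
proof (intro equalityI subsetI)
  fix l assume l: "l \<in> {l \<in> {a<..<b}. l mod m = l0 mod m}"
  have "l0 \<le> l"
  proof (rule ccontr)
    assume "\<not> l0 \<le> l"
    then have "l < l0" by simp
    moreover have "m dvd l0 - l"
      using mod_eq_dvd_iff_nat[of l l0 m] l \<open>l < l0\<close> by simp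
    ultimately have "m \<le> l0 - l" by (simp add: dvd_imp_le)
    then show False using l assms by auto
  qed
  with l have "m dvd l - l0"
    using mod_eq_dvd_iff_nat[of l0 l m] by simp
  then obtain i where "l - l0 = m * i" by (rule dvdE)
  with \<open>l0 \<le> l\<close> have i: "l = l0 + m * i" by simp
  from l have "l < b" by simp
  with i assms(3) have "l0 + m * i < l0 + m * N" by linarith
  then have "i < N" by simp
  with i show "l \<in> (\<lambda>i. l0 + m * i) ` {..<N}" by auto
next
  fix l assume "l \<in> (\<lambda>i. l0 + m * i) ` {..<N}"
  then obtain i where i: "i < N" "l = l0 + m * i" by auto
  have "m * i \<le> m * (N - 1)" using i by (intro mult_le_mono2) linarith
  with i last have "l < b" by linarith
  with i assms(1) show "l \<in> {l \<in> {a<..<b}. l mod m = l0 mod m}" by auto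
qed

text \<open>Position \<open>0\<close> is at the top, the positions \<open>k - h\<close> and \<open>k + h\<close> are at height \<open>h\<close> on the way down and on
the way up, and the pattern repeats with period \<open>2k\<close>.\<close>

definition zigzag :: "nat \<Rightarrow> nat \<Rightarrow> star_exponent" where
  "zigzag k j = (if j mod (2 * k) < k then One_exp else Star_exp)"

definition height :: "nat \<Rightarrow> nat \<Rightarrow> int" where
  "height k j = \<bar>int k - int (j mod (2 * k))\<bar>"

lemma height_Suc: "k > 0 \<Longrightarrow> height k (Suc j) = height k j + step (zigzag k j)"
  using mod_less_divisor[of "2 * k" j]
  by (auto simp: height_def zigzag_def mod_Suc simp del: mod_less_divisor)

lemma zigzag_shift: "zigzag k (j + 2 * k * i) = zigzag k j"
  by (simp add: zigzag_def)

lemma moment_zigzag_shift: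
  assumes "a' = a + 2 * k * i" "b' = b + 2 * k * i"
  shows "moment (zigzag k) a' b' = moment (zigzag k) a b"
  by (simp add: assms moment_shift zigzag_shift)

text \<open>Because of the letter and height conditions, the partners of the first letter that contribute lie in
one residue class modulo the period. Here \<open>l0\<close> is the first of them and \<open>N\<close> their number.\<close>

lemma moment_zigzag_first_arc:
  assumes "k > 0" "a < b"
    and "zigzag k l0 \<noteq> zigzag k a" "height k l0 = height k (Suc a)"
    and "a < l0" "l0 \<le> a + 2 * k" "b \<le> l0 + 2 * k * N" "N = 0 \<or> l0 + 2 * k * (N - 1) < b"
  shows "moment (zigzag k) a b = (\<Sum>i<N. arc_factor (zigzag k a) (zigzag k l0)
    (moment (zigzag k) (Suc a) (l0 + 2 * k * i)) * moment (zigzag k) (Suc (l0 + 2 * k * i)) b)"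
proof -
  let ?f = "\<lambda>l. arc_factor (zigzag k a) (zigzag k l) (moment (zigzag k) (Suc a) l) * moment (zigzag k) (Suc l) b"
  have "?f l = 0" if l: "a < l" "l < b" "l mod (2 * k) \<noteq> l0 mod (2 * k)" for l
  proof (cases "zigzag k l = zigzag k a \<or> height k l \<noteq> height k (Suc a)")
    case True
    then show ?thesis
      using moment_unbalanced[of "height k" "zigzag k" "Suc a" l] height_Suc[OF assms(1)] l
      by (auto simp: arc_factor_eq_0)
  next
    case False
    moreover from this have "zigzag k l = zigzag k l0"
      using assms(3) by (metis star_exponent.exhaust)
    ultimately have False
      using assms(4) l(3) by (auto simp: zigzag_def height_def split: if_splits)
    then show ?thesis ..
  qed
  then have "sum ?f {a<..<b} = sum ?f {l \<in> {a<..<b}. l mod (2 * k) = l0 mod (2 * k)}"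
    by (intro sum.mono_neutral_right) (simp, blast, fastforce)
  moreover have "moment (zigzag k) a b = sum ?f {a<..<b}"
    using assms(2) by (subst moment.simps) simp
  ultimately have "moment (zigzag k) a b = sum ?f {l \<in> {a<..<b}. l mod (2 * k) = l0 mod (2 * k)}"
    by simp
  also have "\<dots> = (\<Sum>i<N. ?f (l0 + 2 * k * i))"
    unfolding residue_class_between[OF assms(5-8)]
    using assms(1) by (subst sum.reindex) (auto simp: inj_on_def)
  finally show ?thesis by (simp add: zigzag_shift)
qed


text \<open>For a height \<open>h \<le> k\<close>, these are the coefficients of the generating functions \<open>p\<^sub>h\<close>, \<open>q\<^sub>h\<close> and (in two
ways) \<open>r\<^sub>h\<close>: the names tell the directions of the path at the first and last position. The exponent is
the number of visits to the top, except that for \<open>h = k\<close> the loops leave out one of their end points and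
\<open>down_to_up\<close> leaves out both; as \<open>up_to_down\<close> visits the top at least once, its coefficient at \<open>0\<close>
is \<open>0\<close>.\<close>

definition up_to_down :: "nat \<Rightarrow> nat \<Rightarrow> nat \<Rightarrow> complex poly" where
  "up_to_down k h n = (case n of 0 \<Rightarrow> 0 | Suc m \<Rightarrow> moment (zigzag k) (k + h) (2 * k + (k - h) + 2 * k * m))"

definition down_to_up :: "nat \<Rightarrow> nat \<Rightarrow> nat \<Rightarrow> complex poly" where
  "down_to_up k h n = moment (zigzag k) (k - h) (k + h + 2 * k * n)"

definition down_to_down :: "nat \<Rightarrow> nat \<Rightarrow> nat \<Rightarrow> complex poly" where
  "down_to_down k h n = moment (zigzag k) (k - h) (k - h + 2 * k * n)"

definition up_to_up :: "nat \<Rightarrow> nat \<Rightarrow> nat \<Rightarrow> complex poly" where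
  "up_to_up k h n = moment (zigzag k) (k + h) (k + h + 2 * k * n)"

text \<open>A step up from height \<open>h\<close> can only be paired with a step down to height \<open>h\<close>. The enclosed word runs
at height \<open>h + 1\<close>, first up and in the end down.\<close>

lemma ascending_first_arc:
  assumes "h < k" "N = 0 \<or> 2 * k + (k - h - 1) + 2 * k * (N - 1) < b" "b \<le> 2 * k + (k - h - 1) + 2 * k * N" "k + h < b"
  shows "moment (zigzag k) (k + h) b = (\<Sum>i<N. pint (up_to_down k (Suc h) (Suc i)) * moment (zigzag k) (2 * k + (k - h) + 2 * k * i) b)"
proof -
  obtain g where g: "k = Suc (h + g)" using assms(1) less_imp_Suc_add by blast
  have 1: "zigzag k (k + h) = Star_exp" "height k (Suc (k + h)) = int h + 1"
    using height_Suc[of k "k + h"] assms(1) by (simp_all add: zigzag_def height_def)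
  have "g < 2 * k" using g by simp
  then have "(2 * k + g) mod (2 * k) = g" by (simp only: mod_add_self1 mod_less)
  then have 2: "zigzag k (2 * k + g) = One_exp" "height k (2 * k + g) = int h + 1"
    using g by (simp_all add: zigzag_def height_def)
  have "moment (zigzag k) (k + h) b = (\<Sum>i<N. arc_factor (zigzag k (k + h)) (zigzag k (2 * k + g))
    (moment (zigzag k) (Suc (k + h)) (2 * k + g + 2 * k * i)) * moment (zigzag k) (Suc (2 * k + g + 2 * k * i)) b)"
    by (rule moment_zigzag_first_arc) (use assms 1 2 g in auto)
  then show ?thesis unfolding 1 2 by (simp add: up_to_down_def g)
qed

text \<open>The mirror image: the enclosed word runs at height \<open>h - 1\<close>, first down and in the end up.\<close>

lemma descending_first_arc:
  assumes "0 < h" "h \<le> k" "N = 0 \<or> k + h - 1 + 2 * k * (N - 1) < b" "b \<le> k + h - 1 + 2 * k * N" "k - h < b"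
  shows "moment (zigzag k) (k - h) b = (\<Sum>i<N. pint_to_1 (down_to_up k (h - 1) i) * moment (zigzag k) (k + h + 2 * k * i) b)"
proof -
  obtain g where g: "k = h + g" using assms(2) le_iff_add by blast
  have 1: "zigzag k g = One_exp" "height k (Suc g) = int h - 1"
    using height_Suc[of k g] assms(1) by (simp_all add: zigzag_def height_def g)
  have 2: "zigzag k (k + h - 1) = Star_exp" "height k (k + h - 1) = int h - 1"
    using assms(1) by (auto simp: zigzag_def height_def g)
  have "moment (zigzag k) g b = (\<Sum>i<N. arc_factor (zigzag k g) (zigzag k (k + h - 1))
    (moment (zigzag k) (Suc g) (k + h - 1 + 2 * k * i)) * moment (zigzag k) (Suc (k + h - 1 + 2 * k * i)) b)"
    by (rule moment_zigzag_first_arc) (use assms 1 2 g in auto)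
  then show ?thesis unfolding 1 2 using assms(1) by (simp add: down_to_up_def g)
qed

lemma up_to_down_rec:
  assumes "h < k"
  shows "up_to_down k h (Suc n) = (\<Sum>i\<le>n. pint (up_to_down k (Suc h) (Suc i)) * down_to_down k h (n - i))"
proof -
  have "up_to_down k h (Suc n) = (\<Sum>i<Suc n. pint (up_to_down k (Suc h) (Suc i)) * moment (zigzag k) (2 * k + (k - h) + 2 * k * i) (2 * k + (k - h) + 2 * k * n))"
    unfolding up_to_down_def[of k h] nat.case by (rule ascending_first_arc) (use assms in simp_all)
  moreover have "moment (zigzag k) (2 * k + (k - h) + 2 * k * i) (2 * k + (k - h) + 2 * k * n) = down_to_down k h (n - i)" if "i \<le> n" for i
    unfolding down_to_down_def
    by (rule moment_zigzag_shift[where i = "Suc i"]) (use that in \<open>auto simp: add_mult_distrib2 dest!: le_Suc_ex\<close>)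
  ultimately show ?thesis
    by (simp add: lessThan_Suc_atMost)
qed

lemma up_to_up_rec:
  assumes "h < k"
  shows "up_to_up k h (Suc n) = (\<Sum>i\<le>n. pint (up_to_down k (Suc h) (Suc i)) * down_to_up k h (n - i))"
proof -
  have "up_to_up k h (Suc n) = (\<Sum>i<Suc n. pint (up_to_down k (Suc h) (Suc i)) * moment (zigzag k) (2 * k + (k - h) + 2 * k * i) (k + h + 2 * k * Suc n))"
    unfolding up_to_up_def by (rule ascending_first_arc) (use assms in simp_all)
  moreover have "moment (zigzag k) (2 * k + (k - h) + 2 * k * i) (k + h + 2 * k * Suc n) = down_to_up k h (n - i)" if "i \<le> n" for i
    unfolding down_to_up_def
    by (rule moment_zigzag_shift[where i = "Suc i"]) (use that in \<open>auto simp: add_mult_distrib2 dest!: le_Suc_ex\<close>)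
  ultimately show ?thesis
    by (simp add: lessThan_Suc_atMost)
qed

lemma down_to_up_rec:
  assumes "0 < h" "h \<le> k"
  shows "down_to_up k h n = (\<Sum>i\<le>n. pint_to_1 (down_to_up k (h - 1) i) * up_to_up k h (n - i))"
proof -
  have "down_to_up k h n = (\<Sum>i<Suc n. pint_to_1 (down_to_up k (h - 1) i) * moment (zigzag k) (k + h + 2 * k * i) (k + h + 2 * k * n))"
    unfolding down_to_up_def[of k h] by (rule descending_first_arc) (use assms in simp_all)
  moreover have "moment (zigzag k) (k + h + 2 * k * i) (k + h + 2 * k * n) = up_to_up k h (n - i)" if "i \<le> n" for i
    unfolding up_to_up_def
    by (rule moment_zigzag_shift[where i = "i"]) (use that in \<open>auto simp: add_mult_distrib2 dest!: le_Suc_ex\<close>)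
  ultimately show ?thesis
    by (simp add: lessThan_Suc_atMost)
qed

lemma down_to_down_rec:
  assumes "0 < h" "h \<le> k"
  shows "down_to_down k h (Suc n) = (\<Sum>i\<le>n. pint_to_1 (down_to_up k (h - 1) i) * up_to_down k h (Suc (n - i)))"
proof -
  have "down_to_down k h (Suc n) = (\<Sum>i<Suc n. pint_to_1 (down_to_up k (h - 1) i) * moment (zigzag k) (k + h + 2 * k * i) (k - h + 2 * k * Suc n))"
    unfolding down_to_down_def by (rule descending_first_arc) (use assms in simp_all)
  moreover have "moment (zigzag k) (k + h + 2 * k * i) (k - h + 2 * k * Suc n) = up_to_down k h (Suc (n - i))" if "i \<le> n" for i
    unfolding up_to_down_def nat.case
    by (rule moment_zigzag_shift[where i = "i"]) (use that in \<open>auto simp: add_mult_distrib2 dest!: le_Suc_ex\<close>)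
  ultimately show ?thesis
    by (simp add: lessThan_Suc_atMost)
qed

section \<open>The periodic word solves the ladder equations\<close>

lemma ser_mult: "ser a * ser b = ser (\<lambda>n. \<Sum>i\<le>n. a i * b (n - i))"
proof (rule fps_ext)
  fix n
  have "fps_const (\<Sum>i\<in>A. f i) = (\<Sum>i\<in>A. fps_const (f i))" for f :: "nat \<Rightarrow> complex poly" and A
    by (induction A rule: infinite_finite_induct) (simp_all flip: fps_const_add)
  then show "(ser a * ser b) $ n = ser (\<lambda>n. \<Sum>i\<le>n. a i * b (n - i)) $ n"
    by (simp add: fps_mult_nth atLeast0AtMost)
qed

lemma ser_eqI: "(\<And>n. a n = b n) \<Longrightarrow> ser a = ser b"
  by (simp add: ser_def)

lemma ev_ser_eq_0: "(\<And>n. poly (a n) c = 0) \<Longrightarrow> ev c (ser a) = 0"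
  by (rule fps_ext) simp

lemma Dx_ser: "Dx (ser a) = ser (\<lambda>n. pderiv (a n))"
  by (intro fps_ext) (simp add: Dx_def)

lemma ser_uminus: "ser (\<lambda>n. - a n) = - ser a"
  by (rule fps_ext) (simp flip: fps_const_neg)

text \<open>The four recursions are the ladder equations in terms of coefficients, except that they involve two
kinds of loops. Both are inverse to \<open>1 - P\<^sub>h Q\<^sub>h\<close>, so they agree.\<close>

theorem integral_zigzag_moment:
  assumes k: "k > 0"
  shows "poly (pint (moment (zigzag k) 0 (2 * k * Suc n))) 1 = of_nat (Suc n) ^ (Suc n * k) / fact (Suc n * k + 1)"
proof -
  define Pc where "Pc h m = (if h < k then pint (up_to_down k (Suc h) m) else if m = 1 then 1 else 0)" for h m
  define Qc where "Qc h m = (if h = 0 then if m = 0 then 1 else 0 else pint_to_1 (down_to_up k (h - 1) m))"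
    for h m
  have Pk: "ser (Pc k) = fps_X" and Q0: "ser (Qc 0) = 1"
    by (rule fps_ext; simp add: Pc_def Qc_def)+
  have up_to_down_0: "up_to_down k h 0 = 0" for h by (simp add: up_to_down_def)
  have shift_loop: "moment (zigzag k) (2 * k) (2 * k + 2 * k * m) = moment (zigzag k) 0 (2 * k * m)" for m
    by (rule moment_zigzag_shift[where i = 1]) simp_all
  have loops_k: "up_to_up k k = down_to_down k k"
    by (rule ext) (simp add: up_to_up_def down_to_down_def shift_loop flip: mult_2)
  have mult_shift: "ser a * ser b = ser (\<lambda>n. case n of 0 \<Rightarrow> 0 | Suc m \<Rightarrow> \<Sum>i\<le>m. a (Suc i) * b (m - i))"
    if "a 0 = 0" for a b
    unfolding ser_mult by (intro ser_eqI) (auto simp: that sum.atMost_Suc_shift simp del: sum.atMost_Suc split: nat.split)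

  have p_eq: "ser (up_to_down k h) = ser (Pc h) * ser (down_to_down k h)" if "h \<le> k" for h
  proof (cases "h = k")
    case True
    have "up_to_down k k (Suc m) = down_to_down k k m" for m
      by (simp add: up_to_down_def down_to_down_def shift_loop flip: mult_2)
    then show ?thesis
      unfolding True Pk by (intro fps_ext) (auto simp: up_to_down_0 gr0_conv_Suc)
  next
    case False
    with that have "h < k" by simp
    then show ?thesis
      by (subst mult_shift[of "Pc h"]) (auto simp: Pc_def up_to_down_0 pint_0 up_to_down_rec intro!: ser_eqI split: nat.split)
  qed
  have r_eq: "ser (down_to_down k h) = 1 + ser (Qc h) * ser (up_to_down k h)" if "h \<le> k" for h
  proof (cases "h = 0")
    case True
    have "down_to_down k 0 (Suc m) = up_to_down k 0 (Suc m)" for m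
      by (simp add: up_to_down_def down_to_down_def algebra_simps)
    moreover have "down_to_down k 0 0 = 1"
      by (simp add: down_to_down_def moment.simps)
    ultimately show ?thesis
      unfolding True Q0 by (intro fps_ext) (auto simp: up_to_down_0 gr0_conv_Suc)
  next
    case False
    have "ser (down_to_down k h) = 1 + ser (up_to_down k h) * ser (Qc h)"
    proof (subst mult_shift[where a = "up_to_down k h" and b = "Qc h", OF up_to_down_0], rule fps_ext)
      fix m
      show "ser (down_to_down k h) $ m = (1 + ser (case_nat 0 (\<lambda>m. \<Sum>i\<le>m. up_to_down k h (Suc i) * Qc h (m - i)))) $ m"
      proof (cases m)
        case 0
        then show ?thesis by (simp add: down_to_down_def moment.simps)
      next
        case (Suc m')
        have "(\<Sum>i\<le>m'. up_to_down k h (Suc i) * Qc h (m' - i)) = (\<Sum>i\<le>m'. Qc h i * up_to_down k h (Suc (m' - i)))"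
          by (rule sum.reindex_bij_witness[of _ "\<lambda>i. m' - i" "\<lambda>i. m' - i"]) (auto simp: mult.commute)
        then show ?thesis using False that Suc by (simp add: down_to_down_rec Qc_def)
      qed
    qed
    then show ?thesis by (simp add: mult.commute)
  qed
  have q_eq: "ser (down_to_up k h) = ser (Qc h) * ser (down_to_down k h)" if "h \<le> k" for h
  proof (cases "h = 0")
    case True
    have "down_to_up k 0 = down_to_down k 0"
      by (rule ext) (simp add: down_to_up_def down_to_down_def)
    then show ?thesis unfolding True Q0 by simp
  next
    case False
    have 1: "ser (down_to_up k h) = ser (Qc h) * ser (up_to_up k h)"
      unfolding ser_mult using False that by (intro ser_eqI) (simp add: down_to_up_rec Qc_def)
    show ?thesis
    proof (cases "h = k")
      case True
      then show ?thesis using 1 loops_k by simp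
    next
      case False
      with that have "h < k" by simp
      then have "ser (up_to_up k h) = 1 + ser (Pc h) * ser (down_to_up k h)"
      proof (subst mult_shift[of "Pc h"], goal_cases)
        case 2
        show ?case
        proof (rule fps_ext)
          fix m
          show "ser (up_to_up k h) $ m =
            (1 + ser (case_nat 0 (\<lambda>m. \<Sum>i\<le>m. Pc h (Suc i) * down_to_up k h (m - i)))) $ m"
            using 2 by (cases m) (simp_all add: up_to_up_rec Pc_def, simp add: up_to_up_def moment.simps)
        qed
      qed (simp add: Pc_def up_to_down_0 pint_0)
      then have "ser (up_to_up k h) * (1 - ser (Pc h) * ser (Qc h)) = 1"
        unfolding 1 by (simp add: algebra_simps)
      moreover have "ser (down_to_down k h) * (1 - ser (Pc h) * ser (Qc h)) = 1"
        using r_eq[OF that] unfolding p_eq[OF that] by (simp add: algebra_simps)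
      moreover have "x = y" if "x * c = 1" "y * c = 1" for x y c :: "complex poly fps fps"
      proof -
        have "x = x * (y * c)" using that by simp
        also have "\<dots> = y * (x * c)" by (simp only: mult.left_commute)
        finally show ?thesis using that by simp
      qed
      ultimately have "ser (up_to_up k h) = ser (down_to_down k h)"
        by blast
      then show ?thesis using 1 by simp
    qed
  qed

  have "poly (pint (down_to_down k k (Suc n))) 1 = of_nat (Suc n) ^ (Suc n * k) / fact (Suc n * k + 1)"
  proof (rule ladder_integral[where Pc = Pc and Qc = Qc and rc = "down_to_down k"])
    show "ser (down_to_down k h) * (1 - ser (Pc h) * ser (Qc h)) = 1" if "h \<le> k" for h
      using r_eq[OF that] unfolding p_eq[OF that] by (simp add: algebra_simps)
    show "Dx (ser (Pc h)) = ser (Pc (Suc h)) * ser (down_to_down k (Suc h))" if "h < k" for h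
      using p_eq[of "Suc h"] that by (simp add: Dx_ser Pc_def[of h] pderiv_pint)
    show "Dx (ser (Qc (Suc h))) = - (ser (Qc h) * ser (down_to_down k h))" if "h < k" for h
      using q_eq[of h] that by (simp add: Dx_ser Qc_def[of "Suc h"] pderiv_pint_to_1 ser_uminus)
    show "ev 0 (ser (Pc h)) = 0" if "h < k" for h
      by (rule ev_ser_eq_0) (simp add: Pc_def that poly_pint_0)
    show "ev 1 (ser (Qc (Suc h))) = 0" for h
      by (rule ev_ser_eq_0) (simp add: Qc_def poly_pint_to_1_1)
    show "down_to_down k k 0 = 1" by (simp add: down_to_down_def moment.simps)
  qed (use k Pk Q0 in auto)
  then show ?thesis by (simp add: down_to_down_def)
qed

section \<open>Noncrossing pair partitions by their first arc\<close>

lemma finite_NC2: "finite (NC2 X)"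
proof (cases "finite X")
  case True
  have "NC2 X \<subseteq> Pow (Pow X)"
    by (auto simp: NC2_def partition_on_def)
  then show ?thesis by (rule finite_subset) (simp add: True)
qed (simp add: NC2_def)

lemma NC2_empty: "NC2 {} = {{}}"
  by (auto simp: NC2_def partition_on_def)

lemma NC2_D:
  assumes "\<pi> \<in> NC2 X"
  shows "\<Union>\<pi> = X" "finite X"
    "\<And>V W x. V \<in> \<pi> \<Longrightarrow> W \<in> \<pi> \<Longrightarrow> x \<in> V \<Longrightarrow> x \<in> W \<Longrightarrow> V = W"
    "\<And>V. V \<in> \<pi> \<Longrightarrow> card V = 2"
    "\<And>a b c d. a < b \<Longrightarrow> b < c \<Longrightarrow> c < d \<Longrightarrow> {a, c} \<in> \<pi> \<Longrightarrow> {b, d} \<in> \<pi> \<Longrightarrow> False"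
proof -
  have part: "partition_on X \<pi>" using assms by (simp add: NC2_def)
  show "\<Union>\<pi> = X" using partition_onD1[OF part] by simp
  show "V = W" if "V \<in> \<pi>" "W \<in> \<pi>" "x \<in> V" "x \<in> W" for V W x
    using disjointD[OF partition_onD2[OF part] that(1,2)] that(3,4) by blast
  show "finite X" "\<And>V. V \<in> \<pi> \<Longrightarrow> card V = 2" using assms by (simp_all add: NC2_def)
  show False if "a < b" "b < c" "c < d" "{a, c} \<in> \<pi>" "{b, d} \<in> \<pi>" for a b c d
    using assms that unfolding NC2_def by blast
qed

lemma NC2_I:
  assumes "\<Union>\<pi> = X" "finite X"
    "\<And>V W x. V \<in> \<pi> \<Longrightarrow> W \<in> \<pi> \<Longrightarrow> x \<in> V \<Longrightarrow> x \<in> W \<Longrightarrow> V = W"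
    "\<And>V. V \<in> \<pi> \<Longrightarrow> card V = 2"
    "\<And>a b c d. a < b \<Longrightarrow> b < c \<Longrightarrow> c < d \<Longrightarrow> {a, c} \<in> \<pi> \<Longrightarrow> {b, d} \<in> \<pi> \<Longrightarrow> False"
  shows "\<pi> \<in> NC2 X"
proof -
  have "{} \<notin> \<pi>" using assms(4)[of "{}"] by auto
  moreover have "disjoint \<pi>" using assms(3) unfolding disjoint_def by blast
  ultimately show ?thesis
    using assms(1,2,4,5) unfolding NC2_def partition_on_def by (simp, blast)
qed

lemma NC2_pairE:
  assumes "\<pi> \<in> NC2 X" "V \<in> \<pi>"
  obtains x y where "V = {x, y}" "x < y" "x \<in> X" "y \<in> X"
proof -
  obtain u v where "V = {u, v}" "u \<noteq> v"
    using NC2_D(4)[OF assms] by (auto simp: card_2_iff)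
  moreover have "V \<subseteq> X" using NC2_D(1)[OF assms(1)] assms(2) by blast
  ultimately show thesis
    using that[of u v] that[of v u] by (cases u v rule: linorder_cases) (auto simp: insert_commute)
qed

lemma partner_eqI:
  assumes "\<pi> \<in> NC2 X" "{i, l} \<in> \<pi>"
  shows "partner \<pi> i = l"
proof -
  have "i \<in> X" using NC2_D(1)[OF assms(1)] assms(2) by blast
  have "{i, partner \<pi> i} = {i, l}"
    by (rule NC2_D(3)[OF assms(1) partner_in_block[OF assms(1) \<open>i \<in> X\<close>] assms(2), of i]) simp_all
  moreover have "i \<noteq> l" using NC2_D(4)[OF assms] by auto
  ultimately show ?thesis by (auto simp: doubleton_eq_iff)
qed

text \<open>\<open>join_arc a\<close> and \<open>cut_arc a\<close> are mutually inverse bijections between the pairings of \<open>{a..<b}\<close> and the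
triples that consist of the partner \<open>l\<close> of \<open>a\<close>, a pairing inside the arc from \<open>a\<close> to \<open>l\<close>, and a pairing
to the right of it.\<close>

definition join_arc :: "nat \<Rightarrow> nat \<times> nat set set \<times> nat set set \<Rightarrow> nat set set" where
  "join_arc a = (\<lambda>(l, \<sigma>, \<tau>). insert {a, l} (\<sigma> \<union> \<tau>))"

definition cut_arc :: "nat \<Rightarrow> nat set set \<Rightarrow> nat \<times> nat set set \<times> nat set set" where
  "cut_arc a \<pi> = (partner \<pi> a, restrict_blocks \<pi> {a<..<partner \<pi> a}, restrict_blocks \<pi> {partner \<pi> a<..})"

lemma join_arc_NC2:
  assumes l: "l \<in> {a<..<b}" and \<sigma>: "\<sigma> \<in> NC2 {Suc a..<l}" and \<tau>: "\<tau> \<in> NC2 {Suc l..<b}"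
  shows "join_arc a (l, \<sigma>, \<tau>) \<in> NC2 {a..<b}" and "cut_arc a (join_arc a (l, \<sigma>, \<tau>)) = (l, \<sigma>, \<tau>)"
proof -
  let ?\<pi> = "insert {a, l} (\<sigma> \<union> \<tau>)"
  have in_\<sigma>: "a < x \<and> x < l" if "V \<in> \<sigma>" "x \<in> V" for V x
  proof -
    have "x \<in> \<Union>\<sigma>" using that by (rule UnionI)
    then show ?thesis unfolding NC2_D(1)[OF \<sigma>] by auto
  qed
  have in_\<tau>: "l < x \<and> x < b" if "V \<in> \<tau>" "x \<in> V" for V x
  proof -
    have "x \<in> \<Union>\<tau>" using that by (rule UnionI)
    then show ?thesis unfolding NC2_D(1)[OF \<tau>] by auto
  qed
  have \<pi>: "?\<pi> \<in> NC2 {a..<b}"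
  proof (rule NC2_I)
    have "{a..<b} = insert a (insert l ({Suc a..<l} \<union> {Suc l..<b}))" using l by auto
    then show "\<Union>?\<pi> = {a..<b}" using NC2_D(1)[OF \<sigma>] NC2_D(1)[OF \<tau>] by auto
  next
    fix V W x assume *: "V \<in> ?\<pi>" "W \<in> ?\<pi>" "x \<in> V" "x \<in> W"
    have "a < l" using l by simp
    from * show "V = W"
      using in_\<sigma>[of V x] in_\<sigma>[of W x] in_\<tau>[of V x] in_\<tau>[of W x] \<open>a < l\<close>
        NC2_D(3)[OF \<sigma>, of V W x] NC2_D(3)[OF \<tau>, of V W x]
      by auto
  next
    fix V assume "V \<in> ?\<pi>"
    then show "card V = 2" using NC2_D(4)[OF \<sigma>] NC2_D(4)[OF \<tau>] l by auto
  next
    fix u v w z assume *: "u < v" "v < w" "w < z" "{u, w} \<in> ?\<pi>" "{v, z} \<in> ?\<pi>"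
    have 1: "(u = a \<and> w = l) \<or> ({u, w} \<in> \<sigma> \<and> a < u \<and> w < l) \<or> ({u, w} \<in> \<tau> \<and> l < u)"
      using *(4) in_\<sigma>[of "{u, w}"] in_\<tau>[of "{u, w}"] *(1,2) l by (auto simp: doubleton_eq_iff)
    have 2: "(v = a \<and> z = l) \<or> ({v, z} \<in> \<sigma> \<and> a < v \<and> z < l) \<or> ({v, z} \<in> \<tau> \<and> l < v)"
      using *(5) in_\<sigma>[of "{v, z}"] in_\<tau>[of "{v, z}"] *(2,3) l by (auto simp: doubleton_eq_iff)
    have 3: "\<not> ({u, w} \<in> \<sigma> \<and> {v, z} \<in> \<sigma>)" "\<not> ({u, w} \<in> \<tau> \<and> {v, z} \<in> \<tau>)"
      using NC2_D(5)[OF \<sigma> *(1-3)] NC2_D(5)[OF \<tau> *(1-3)] by blast+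
    from 1 2 3 *(1-3) show False by auto
  qed simp
  then show "join_arc a (l, \<sigma>, \<tau>) \<in> NC2 {a..<b}" by (simp add: join_arc_def)
  have p: "partner ?\<pi> a = l" by (rule partner_eqI[OF \<pi>]) simp
  have ne: "V \<noteq> {}" if "V \<in> ?\<pi>" for V
    using NC2_D(4)[OF \<pi> that] by auto
  have "restrict_blocks ?\<pi> {a<..<l} = \<sigma>"
  proof (intro equalityI subsetI)
    fix V assume V: "V \<in> restrict_blocks ?\<pi> {a<..<l}"
    with ne obtain x where "x \<in> V" by (auto simp: restrict_blocks_def)
    with V have "V \<notin> \<tau>" using in_\<tau>[of V x] by (auto simp: restrict_blocks_def)
    moreover have "V \<noteq> {a, l}" using V l by (auto simp: restrict_blocks_def)
    ultimately show "V \<in> \<sigma>" using V by (auto simp: restrict_blocks_def)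
  next
    fix V assume "V \<in> \<sigma>"
    then show "V \<in> restrict_blocks ?\<pi> {a<..<l}" using in_\<sigma>[of V] by (auto simp: restrict_blocks_def)
  qed
  moreover have "restrict_blocks ?\<pi> {l<..} = \<tau>"
  proof (intro equalityI subsetI)
    fix V assume V: "V \<in> restrict_blocks ?\<pi> {l<..}"
    with ne obtain x where "x \<in> V" by (auto simp: restrict_blocks_def)
    with V have "V \<notin> \<sigma>" using in_\<sigma>[of V x] by (auto simp: restrict_blocks_def)
    moreover have "V \<noteq> {a, l}" using V l by (auto simp: restrict_blocks_def)
    ultimately show "V \<in> \<tau>" using V by (auto simp: restrict_blocks_def)
  next
    fix V assume "V \<in> \<tau>"
    then show "V \<in> restrict_blocks ?\<pi> {l<..}" using in_\<tau>[of V] by (auto simp: restrict_blocks_def)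
  qed
  ultimately show "cut_arc a (join_arc a (l, \<sigma>, \<tau>)) = (l, \<sigma>, \<tau>)"
    by (simp add: cut_arc_def join_arc_def p)
qed

lemma NC2_restrict_blocks:
  assumes \<pi>: "\<pi> \<in> NC2 X" and "Y \<subseteq> X" and Y: "\<And>V x. V \<in> \<pi> \<Longrightarrow> x \<in> V \<Longrightarrow> x \<in> Y \<Longrightarrow> V \<subseteq> S"
    and SY: "\<And>V. V \<in> \<pi> \<Longrightarrow> V \<subseteq> S \<Longrightarrow> V \<subseteq> Y"
  shows "restrict_blocks \<pi> S \<in> NC2 Y"
proof (rule NC2_I)
  show "\<Union>(restrict_blocks \<pi> S) = Y"
  proof (intro equalityI subsetI)
    fix x assume "x \<in> Y"
    then obtain V where "V \<in> \<pi>" "x \<in> V" using NC2_D(1)[OF \<pi>] \<open>Y \<subseteq> X\<close> by blast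
    then show "x \<in> \<Union>(restrict_blocks \<pi> S)" using Y \<open>x \<in> Y\<close> by (auto simp: restrict_blocks_def)
  qed (use SY in \<open>auto simp: restrict_blocks_def\<close>)
  show "finite Y" using \<open>Y \<subseteq> X\<close> NC2_D(2)[OF \<pi>] by (rule finite_subset)
qed (use NC2_D(3-5)[OF \<pi>] in \<open>auto simp: restrict_blocks_def\<close>)

text \<open>A block that does not touch the arc \<open>{a, l}\<close> cannot have one end inside and the other to the right of
it, since that would be a crossing.\<close>

lemma cut_arc_NC2:
  assumes \<pi>: "\<pi> \<in> NC2 {a..<b}" and "a < b"
  shows "cut_arc a \<pi> \<in> (SIGMA l:{a<..<b}. NC2 {Suc a..<l} \<times> NC2 {Suc l..<b})"
    and "join_arc a (cut_arc a \<pi>) = \<pi>"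
proof -
  define l where "l = partner \<pi> a"
  have al: "{a, l} \<in> \<pi>"
    unfolding l_def by (rule partner_in_block[OF \<pi>]) (use assms(2) in simp)
  have "a \<noteq> l" using NC2_D(4)[OF \<pi> al] by auto
  moreover have "l \<in> {a..<b}" using NC2_D(1)[OF \<pi>] al by blast
  ultimately have l: "l \<in> {a<..<b}" by auto
  have blocks: "V = {a, l} \<or> V \<subseteq> {a<..<l} \<or> V \<subseteq> {l<..<b}" if V: "V \<in> \<pi>" for V
  proof (rule ccontr)
    assume neg: "\<not> ?thesis"
    obtain x y where xy: "V = {x, y}" "x < y" "x \<in> {a..<b}" "y \<in> {a..<b}"
      using NC2_pairE[OF \<pi> V] .
    have "a \<notin> V" "l \<notin> V" using NC2_D(3)[OF \<pi> V al] neg by auto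
    with xy neg have "a < x" "x < l" "l < y" by auto
    then show False using NC2_D(5)[OF \<pi>, of a x l y] al V xy(1) by simp
  qed
  have "restrict_blocks \<pi> {a<..<l} \<in> NC2 {Suc a..<l}"
  proof (rule NC2_restrict_blocks[OF \<pi>])
    show "V \<subseteq> {a<..<l}" if "V \<in> \<pi>" "x \<in> V" "x \<in> {Suc a..<l}" for V x
      using blocks[OF that(1)] that by auto
  qed (use l in auto)
  moreover have "restrict_blocks \<pi> {l<..} \<in> NC2 {Suc l..<b}"
  proof (rule NC2_restrict_blocks[OF \<pi>])
    show "V \<subseteq> {l<..}" if "V \<in> \<pi>" "x \<in> V" "x \<in> {Suc l..<b}" for V x
      using blocks[OF that(1)] that l by auto
    show "V \<subseteq> {Suc l..<b}" if "V \<in> \<pi>" "V \<subseteq> {l<..}" for V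
      using NC2_D(1)[OF \<pi>] that by fastforce
  qed (use l in auto)
  ultimately show "cut_arc a \<pi> \<in> (SIGMA l:{a<..<b}. NC2 {Suc a..<l} \<times> NC2 {Suc l..<b})"
    using l by (simp add: cut_arc_def l_def)
  have "insert {a, l} (restrict_blocks \<pi> {a<..<l} \<union> restrict_blocks \<pi> {l<..}) = \<pi>"
    using al blocks by (fastforce simp: restrict_blocks_def)
  then show "join_arc a (cut_arc a \<pi>) = \<pi>"
    by (simp add: cut_arc_def join_arc_def l_def)
qed

lemma nested_empty: "nested \<kappa> x {} = 1"
  by (simp add: nested.simps)

lemma nested_join_arc:
  assumes l: "l \<in> {a<..<b}" and \<sigma>: "\<sigma> \<in> NC2 {Suc a..<l}" and \<tau>: "\<tau> \<in> NC2 {Suc l..<b}"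
  shows "nested \<kappa> x (join_arc a (l, \<sigma>, \<tau>)) = \<kappa> (x a) (nested \<kappa> x \<sigma> * x l) * nested \<kappa> x \<tau>"
proof -
  let ?\<pi> = "join_arc a (l, \<sigma>, \<tau>)"
  have \<pi>: "?\<pi> \<in> NC2 {a..<b}" by (rule join_arc_NC2[OF assms])
  have "\<Union>?\<pi> = {a..<b}" by (rule NC2_D(1)[OF \<pi>])
  moreover have "Min {a..<b} = a" using l by (intro Min_eqI) auto
  moreover have "?\<pi> \<noteq> {}" by (simp add: join_arc_def)
  ultimately have "nested \<kappa> x ?\<pi> = \<kappa> (x a) (nested \<kappa> x (restrict_blocks ?\<pi> {a<..<partner ?\<pi> a}) * x (partner ?\<pi> a))
      * nested \<kappa> x (restrict_blocks ?\<pi> {partner ?\<pi> a<..})"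
    using \<pi> by (subst nested.simps) (simp add: Let_def)
  moreover have p: "partner ?\<pi> a = l"
    using join_arc_NC2(2)[OF assms] by (simp add: cut_arc_def)
  moreover have "restrict_blocks ?\<pi> {a<..<l} = \<sigma>" "restrict_blocks ?\<pi> {l<..} = \<tau>"
    using join_arc_NC2(2)[OF assms] unfolding cut_arc_def p by simp_all
  ultimately show ?thesis by simp
qed

text \<open>The nested evaluation is defined by cutting at the first arc, so summation over all pairings turns it
into a recursion over intervals; \<open>\<kappa> (x a)\<close> has to be additive to absorb the sum over inner pairings.\<close>

theorem sum_nested_first_arc:
  fixes \<kappa> :: "'a::ring_1 \<Rightarrow> 'a \<Rightarrow> 'a" and x :: "nat \<Rightarrow> 'a"
  assumes additive: "\<And>u v. \<kappa> (x a) (u + v) = \<kappa> (x a) u + \<kappa> (x a) v" and "a < b"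
  shows "(\<Sum>\<pi>\<in>NC2 {a..<b}. nested \<kappa> x \<pi>) =
    (\<Sum>l\<in>{a<..<b}. \<kappa> (x a) ((\<Sum>\<sigma>\<in>NC2 {Suc a..<l}. nested \<kappa> x \<sigma>) * x l) * (\<Sum>\<tau>\<in>NC2 {Suc l..<b}. nested \<kappa> x \<tau>))"
proof -
  let ?D = "SIGMA l:{a<..<b}. NC2 {Suc a..<l} \<times> NC2 {Suc l..<b}"
  have "(\<Sum>\<pi>\<in>NC2 {a..<b}. nested \<kappa> x \<pi>) = (\<Sum>p\<in>?D. nested \<kappa> x (join_arc a p))"
    by (rule sum.reindex_bij_witness[of _ "join_arc a" "cut_arc a"])
       (use cut_arc_NC2[OF _ \<open>a < b\<close>] join_arc_NC2 in \<open>auto simp del: greaterThanLessThan_iff\<close>)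
  also have "\<dots> = (\<Sum>(l, \<sigma>, \<tau>)\<in>?D. \<kappa> (x a) (nested \<kappa> x \<sigma> * x l) * nested \<kappa> x \<tau>)"
    by (rule sum.cong[OF refl]) (auto simp: nested_join_arc simp del: greaterThanLessThan_iff)
  also have "\<dots> = (\<Sum>l\<in>{a<..<b}. \<Sum>(\<sigma>, \<tau>)\<in>NC2 {Suc a..<l} \<times> NC2 {Suc l..<b}.
      \<kappa> (x a) (nested \<kappa> x \<sigma> * x l) * nested \<kappa> x \<tau>)"
    by (rule sum.Sigma[symmetric]) (auto intro!: finite_cartesian_product finite_NC2)
  also have "\<dots> = (\<Sum>l\<in>{a<..<b}. (\<Sum>\<sigma>\<in>NC2 {Suc a..<l}. \<kappa> (x a) (nested \<kappa> x \<sigma> * x l))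
      * (\<Sum>\<tau>\<in>NC2 {Suc l..<b}. nested \<kappa> x \<tau>))"
    by (simp only: sum_product sum.cartesian_product)
  also have "\<dots> = (\<Sum>l\<in>{a<..<b}. \<kappa> (x a) ((\<Sum>\<sigma>\<in>NC2 {Suc a..<l}. nested \<kappa> x \<sigma>) * x l)
      * (\<Sum>\<tau>\<in>NC2 {Suc l..<b}. nested \<kappa> x \<tau>))"
    by (simp only: sum_distrib_right additive_sum[of "\<kappa> (x a)", OF additive])
  finally show ?thesis .
qed

section \<open>Moments of the triangular operator\<close>

lemma integral_poly_of_real:
  fixes p :: "complex poly"
  assumes "u \<le> v"
  shows "((\<lambda>t. poly p (of_real t)) has_integral
    (poly (pint p) (of_real v) - poly (pint p) (of_real u))) {u..v}"
proof (rule fundamental_theorem_of_calculus[OF assms])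
  fix t :: real
  have "(poly (pint p) has_field_derivative poly p (of_real t)) (at (of_real t))"
    using poly_DERIV[of "pint p" "of_real t"] by (simp add: pderiv_pint)
  then show "((\<lambda>t. poly (pint p) (of_real t)) has_vector_derivative poly p (of_real t)) (at t within {u..v})"
    by (rule has_vector_derivative_real_field)
qed

lemma poly_eqI_unit_interval:
  fixes p q :: "complex poly"
  assumes "\<And>t. t \<in> {0..1} \<Longrightarrow> poly p (of_real t) = poly q (of_real t)"
  shows "p = q"
proof (rule ccontr)
  assume "p \<noteq> q"
  then have "finite {z. poly (p - q) z = 0}"
    by (intro poly_roots_finite) simp
  moreover have "(of_real :: real \<Rightarrow> complex) ` {0..1} \<subseteq> {z. poly (p - q) z = 0}"
    using assms by auto
  ultimately have "finite ((of_real :: real \<Rightarrow> complex) ` {0..1})"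
    by (rule rev_finite_subset)
  then have "finite {0..1::real}"
    by (rule finite_imageD) (simp add: inj_on_def)
  then show False using infinite_Icc[of "0::real" 1] by simp
qed

lemma prod_list_map_const:
  assumes "\<And>x. x \<in> set xs \<Longrightarrow> f x = c"
  shows "prod_list (map f xs) = (c :: 'a::monoid_mult) ^ length xs"
  using assms by (induction xs) auto

lemma power_as_zigzag_word:
  fixes f :: "star_exponent \<Rightarrow> 'a::monoid_mult"
  shows "(f One_exp ^ k * f Star_exp ^ k) ^ n = prod_list (map (\<lambda>j. f (zigzag k j)) [0..<2 * k * n])"
proof (induction n)
  case (Suc n)
  have "prod_list (map (\<lambda>j. f (zigzag k j)) [0..<k]) = f One_exp ^ k"
    by (subst prod_list_map_const[where c = "f One_exp"]) (auto simp: zigzag_def)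
  moreover have "prod_list (map (\<lambda>j. f (zigzag k j)) [k..<2 * k]) = f Star_exp ^ k"
    by (subst prod_list_map_const[where c = "f Star_exp"]) (auto simp: zigzag_def)
  moreover have "[0..<2 * k] = [0..<k] @ [k..<2 * k]"
    using upt_add_eq_append[of 0 k k] by (simp add: mult_2)
  ultimately have "prod_list (map (\<lambda>j. f (zigzag k j)) [0..<2 * k]) = f One_exp ^ k * f Star_exp ^ k"
    by simp
  moreover have "[0..<2 * k * Suc n] = [0..<2 * k * n] @ map (\<lambda>j. j + 2 * k * n) [0..<2 * k]"
    using upt_add_eq_append[of 0 "2 * k * n" "2 * k"] map_add_upt[of "2 * k * n" "2 * k"]
    by (simp add: add.commute)
  ultimately show ?case
    by (simp only: power_Suc2 Suc.IH map_append prod_list.append map_map o_def zigzag_shift)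
qed simp

context triangular_operator
begin

lemma iota_inj: "inj \<iota>"
  using iota_bij by (rule bij_betw_imp_inj_on)

lemma iota_in_B: "\<iota> p \<in> B"
  using iota_bij by (auto simp: bij_betw_def)

lemma eval_B_iota: "eval_B \<iota> (\<iota> p) x = poly p (of_real x)"
  by (simp add: eval_B_def inv_f_f[OF iota_inj])

lemma iota_0: "\<iota> 0 = 0"
  using iota_add[of 0 0] by simp

lemma iota_sum: "\<iota> (sum f A) = (\<Sum>a\<in>A. \<iota> (f a))"
  by (rule additive_sum[of \<iota>, OF iota_add])

text \<open>An element of \<open>B\<close> is known once its values on \<open>[0, 1]\<close> are, as a polynomial with infinitely many zeros
vanishes.\<close>

lemma eq_iotaI:
  assumes "b \<in> B" "\<And>x. x \<in> {0..1} \<Longrightarrow> eval_B \<iota> b x = poly q (of_real x)"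
  shows "b = \<iota> q"
proof -
  obtain p where p: "b = \<iota> p" using assms(1) iota_bij by (auto simp: bij_betw_def)
  have "p = q"
    using assms(2) unfolding p eval_B_iota by (rule poly_eqI_unit_interval)
  then show ?thesis using p by simp
qed

lemma kappa_B: "\<kappa> a b \<in> B" and kappa_add: "\<kappa> a (b + c) = \<kappa> a b + \<kappa> a c"
proof -
  have "B_bilinear \<kappa>" using circular by (simp add: generalized_circular_def)
  then show "\<kappa> a b \<in> B" and "\<kappa> a (b + c) = \<kappa> a b + \<kappa> a c"
    by (simp_all add: B_bilinear_def Vector_Spaces.linear_def module_hom_def module_hom_axioms_def)
qed

lemma kappa_iota: "\<kappa> (star_pow T u) (\<iota> p * star_pow T v) = \<iota> (arc_factor u v p)"
proof (cases u; cases v)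
  assume "u = One_exp" "v = Star_exp"
  moreover have "\<kappa> T (\<iota> p * star T) = \<iota> (pint_to_1 p)"
  proof (rule eq_iotaI[OF kappa_B])
    fix x :: real assume x: "x \<in> {0..1}"
    show "eval_B \<iota> (\<kappa> T (\<iota> p * star T)) x = poly (pint_to_1 p) (of_real x)"
      using integral_unique[OF integral_poly_of_real[of x 1 p]] x
      unfolding variance_T_star[OF iota_in_B x] eval_B_iota by (simp add: pint_to_1_def)
  qed
  ultimately show ?thesis by simp
next
  assume "u = Star_exp" "v = One_exp"
  moreover have "\<kappa> (star T) (\<iota> p * T) = \<iota> (pint p)"
  proof (rule eq_iotaI[OF kappa_B])
    fix x :: real assume x: "x \<in> {0..1}"
    show "eval_B \<iota> (\<kappa> (star T) (\<iota> p * T)) x = poly (pint p) (of_real x)"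
      using integral_unique[OF integral_poly_of_real[of 0 x p]] x
      unfolding variance_star_T[OF iota_in_B x] eval_B_iota by (simp add: poly_pint_0)
  qed
  ultimately show ?thesis by simp
qed (simp_all add: iota_0 variance_T_T variance_star_star iota_in_B)

lemma sum_nested_eq_moment:
  "(\<Sum>\<pi>\<in>NC2 {a..<b}. nested \<kappa> (\<lambda>i. star_pow T (s i)) \<pi>) = \<iota> (moment s a b)"
proof (induction "b - a" arbitrary: a b rule: less_induct)
  case less
  show ?case
  proof (cases "b \<le> a")
    case True
    then show ?thesis by (simp add: NC2_empty nested_empty moment.simps iota_one)
  next
    case False
    then have "a < b" by simp
    have "(\<Sum>\<pi>\<in>NC2 {a..<b}. nested \<kappa> (\<lambda>i. star_pow T (s i)) \<pi>) =
        (\<Sum>l\<in>{a<..<b}. \<kappa> (star_pow T (s a)) (\<iota> (moment s (Suc a) l) * star_pow T (s l)) * \<iota> (moment s (Suc l) b))"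
      by (subst sum_nested_first_arc[OF kappa_add \<open>a < b\<close>]) (auto intro!: sum.cong simp: less)
    also have "\<dots> = \<iota> (moment s a b)"
      using \<open>a < b\<close> by (subst (3) moment.simps) (simp add: kappa_iota iota_sum iota_mult)
    finally show ?thesis .
  qed
qed

lemma E_power: "E ((T ^ k * star T ^ k) ^ n) = \<iota> (moment (zigzag k) 0 (2 * k * n))"
proof -
  define s where "s i = zigzag k (i - 1)" for i
  have one_B: "1 \<in> B" using iota_in_B[of 1] by (simp add: iota_one)
  have "(T ^ k * star T ^ k) ^ n = prod_list (map (\<lambda>j. star_pow T (zigzag k j)) [0..<2 * k * n])"
    using power_as_zigzag_word[of "star_pow T"] by simp
  also have "map (\<lambda>j. star_pow T (zigzag k j)) [0..<2 * k * n] =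
      map (\<lambda>i. 1 * star_pow T (s i)) [1..<2 * (k * n) + 1]"
    by (simp add: map_Suc_upt[symmetric] s_def o_def mult.assoc del: upt_Suc)
  also have "E (prod_list \<dots>) = (\<Sum>\<pi>\<in>NC2 {1..2 * (k * n)}. nested \<kappa> (\<lambda>i. 1 * star_pow T (s i)) \<pi>)"
    using circular[unfolded generalized_circular_def, THEN conjunct2, THEN spec, of "k * n",
        THEN spec, of "\<lambda>_. 1", THEN spec, of s] one_B
    by (simp only: simp_thms)
  also have "\<dots> = \<iota> (moment s 1 (2 * (k * n) + 1))"
    using sum_nested_eq_moment[of s 1 "2 * (k * n) + 1"]
    by (simp add: atLeastLessThanSuc_atLeastAtMost)
  also have "moment s 1 (2 * (k * n) + 1) = moment (zigzag k) 0 (2 * k * n)"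
    using moment_shift[of s 0 1 "2 * k * n"] by (simp add: s_def mult.assoc)
  finally show ?thesis .
qed

end

theorem theorem7:
  fixes scale :: "complex \<Rightarrow> 'a::ring_1 \<Rightarrow> 'a" and star :: "'a \<Rightarrow> 'a"
    and B :: "'a set" and E :: "'a \<Rightarrow> 'a" and \<iota> :: "complex poly \<Rightarrow> 'a"
    and \<kappa> :: "'a \<Rightarrow> 'a \<Rightarrow> 'a" and T :: 'a and k n :: nat
  assumes "triangular_operator scale star B E \<iota> \<kappa> T"
    and "k \<ge> 1" and "n \<ge> 1"
  shows "state_phi \<iota> E ((T ^ k * star T ^ k) ^ n) = of_nat (n ^ (n * k)) / fact (n * k + 1)"
proof -
  interpret triangular_operator scale star B E \<iota> \<kappa> T by fact
  obtain m where n: "n = Suc m" using assms(3) by (cases n) auto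
  have "state_phi \<iota> E ((T ^ k * star T ^ k) ^ n) = poly (pint (moment (zigzag k) 0 (2 * k * n))) 1"
    using integral_unique[OF integral_poly_of_real[of 0 1]]
    unfolding state_phi_def E_power eval_B_iota by (simp add: poly_pint_0)
  also have "\<dots> = of_nat n ^ (n * k) / fact (n * k + 1)"
    unfolding n by (rule integral_zigzag_moment) (use assms(2) in simp)
  finally show ?thesis by simp
qed

end
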